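(* Let $k$ be an algebraically closed field of characteristic $p>0$, let $H$ be a linear algebraic group over $k$ with Lie algebra $\mathfrak{h}$, and let $\mathcal{E}:\mathcal{N}_1(\mathfrak{h})\to H$ be an exponential map for $H$. Let $r\ge 1$. Then the map $$\mathcal{E}_*: \mathcal{C}_r(\mathcal{N}_1(\mathfrak{h})) \rightarrow \mathrm{Hom}_{grp/k}(\mathbb{G}_{a(r)},H),\qquad \mathcal{E}_*(X_0,\ldots,X_{r-1}) = \left.\mathcal{E}_{X_0}\,\mathcal{E}_{X_1}^{(1)}\cdots \mathcal{E}_{X_{r-1}}^{(r-1)}\right|_{\mathbb{G}_{a(r)}},$$ is a bijection.
   Context: The restricted nullcone is $\mathcal{N}_1(\mathfrak{h})=\{x\in\mathfrak{h} : x^{[p]}=0\}$, where $x\mapsto x^{[p]}$ is the $[p]$-mapping of $\mathfrak{h}=\mathrm{Lie}(H)$. $\mathcal{C}_r(\mathcal{N}_1(\mathfrak{h}))$ is the variety of $r$-tuples $(X_0,\ldots,X_{r-1})$ of pairwise commuting ($[X_i,X_j]=0$) elements of $\mathcal{N}_1(\mathfrak{h})$. $\mathbb{G}_{a(r)}$ is the $r$-th Frobenius kernel of the additive group $\mathbb{G}_a$ over $k$, and $\mathrm{Hom}_{grp/k}(\mathbb{G}_{a(r)},H)$ is the set of homomorphisms of $k$-group schemes from $\mathbb{G}_{a(r)}$ to $H$ (where $H$ is also viewed as an affine group scheme over $k$). Write $k[\mathbb{G}_a]=k[t]$ and let $u_0\in Dist(\mathbb{G}_a)$ be the element with $u_0(t^i)=\delta_{1i}$,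 i.e. the standard generator of $\mathrm{Lie}(\mathbb{G}_a)$. An exponential map for $H$ is an injective map $\mathcal{E}: \mathcal{N}_1(\mathfrak{h}) \rightarrow H$ which is $H$-equivariant (for the adjoint action on $\mathfrak{h}$ and conjugation on $H$), such that for each $X \in \mathcal{N}_1(\mathfrak{h})$: (1) the map $\mathcal{E}_X:\mathbb{G}_a\to H$, $s\mapsto\mathcal{E}(sX)$, is a one-parameter additive subgroup of $H$ (a homomorphism of algebraic groups $\mathbb{G}_a\to H$) whose differential maps $u_0$ to $X$; (2) the one-parameter subgroup $\mathcal{E}_X(\mathbb{G}_a)$ acts trivially in the adjoint action on the centralizer $C_{\mathfrak{h}}(X)=\{Y\in\mathfrak{h}:[X,Y]=0\}$. Let $F:\mathbb{G}_a\to\mathbb{G}_a$, $F(s)=s^p$, and for $i\ge 0$ put $\mathcal{E}_X^{(i)}=\mathcal{E}_X\circ F^i$. For a tuple $(X_0,\ldots,X_{r-1})\in\mathcal{C}_r(\mathcal{N}_1(\mathfrak{h}))$, the product $\mathcal{E}_{X_0}\mathcal{E}_{X_1}^{(1)}\cdots \mathcal{E}_{X_{r-1}}^{(r-1)}$ is the one-parameter subgroup of $H$ given by $s\mapsto \mathcal{E}(sX_0)\mathcal{E}(s^pX_1)\cdots\mathcal{E}(s^{p^{r-1}}X_{r-1})$ (this is a homomorphism because $\mathcal{E}(X)$ and $\mathcal{E}(Y)$ commute whenever $X,Y\in\mathcal{N}_1(\mathfrak{h})$ with $[X,Y]=0$). *)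

theory Defs
  imports "HOL-Algebra.Group" "HOL-Computational_Algebra.Computational_Algebra"
begin

section \<open>Linear algebraic groups\<close>

text \<open>
  An affine variety over an algebraically closed field is a set \<open>S\<close> with a finitely generated
  algebra \<open>A\<close> of functions on \<open>S\<close> such that evaluation identifies \<open>S\<close> with the set of all algebra
  homomorphisms from \<open>A\<close> to the field. Functions on \<open>S\<close> are extensional, i.e. \<open>undefined\<close>
  outside \<open>S\<close>.
\<close>

definition function_algebra :: "'a set \<Rightarrow> ('a \<Rightarrow> 'k::field) set \<Rightarrow> bool" where
  "function_algebra S A \<longleftrightarrow>
     A \<subseteq> extensional S \<and>
     (\<forall>c. (\<lambda>x\<in>S. c) \<in> A) \<and>
     (\<forall>f\<in>A. \<forall>g\<in>A. (\<lambda>x\<in>S. f x + g x) \<in> A) \<and>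
     (\<forall>f\<in>A. \<forall>g\<in>A. (\<lambda>x\<in>S. f x * g x) \<in> A)"

definition algebra_character :: "'a set \<Rightarrow> ('a \<Rightarrow> 'k::field) set \<Rightarrow> (('a \<Rightarrow> 'k) \<Rightarrow> 'k) \<Rightarrow> bool" where
  "algebra_character S A \<chi> \<longleftrightarrow>
     (\<forall>c. \<chi> (\<lambda>x\<in>S. c) = c) \<and>
     (\<forall>f\<in>A. \<forall>g\<in>A. \<chi> (\<lambda>x\<in>S. f x + g x) = \<chi> f + \<chi> g) \<and>
     (\<forall>f\<in>A. \<forall>g\<in>A. \<chi> (\<lambda>x\<in>S. f x * g x) = \<chi> f * \<chi> g)"

definition affine_variety :: "'a set \<Rightarrow> ('a \<Rightarrow> 'k::alg_closed_field) set \<Rightarrow> bool" where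
  "affine_variety S A \<longleftrightarrow>
     function_algebra S A \<and>
     (\<exists>F. finite F \<and> F \<subseteq> A \<and> function_algebra S hull F = A) \<and>
     (\<forall>\<chi>. algebra_character S A \<chi> \<longrightarrow> (\<exists>!x. x \<in> S \<and> (\<forall>f\<in>A. \<chi> f = f x)))"

record ('a, 'k) alg_group = "'a monoid" +
  coord :: "('a \<Rightarrow> 'k) set"

text \<open>
  A list \<open>ts\<close> of pairs of regular functions stands for the tensor \<open>\<Sum> g \<otimes> h\<close> over
  \<open>(g, h)\<close> in \<open>ts\<close>; it represents the comultiplication of \<open>f\<close> iff
  \<open>f (x y) = \<Sum> g x * h y\<close> for all points \<open>x\<close>, \<open>y\<close>, because
  \<open>k[H] \<otimes> k[H]\<close> embeds into the functions on \<open>H \<times> H\<close>.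
\<close>

definition represents_comult ::
  "('a, 'k::field) alg_group \<Rightarrow> ('a \<Rightarrow> 'k) \<Rightarrow> (('a \<Rightarrow> 'k) \<times> ('a \<Rightarrow> 'k)) list \<Rightarrow> bool" where
  "represents_comult H f ts \<longleftrightarrow>
     set ts \<subseteq> coord H \<times> coord H \<and>
     (\<forall>x\<in>carrier H. \<forall>y\<in>carrier H. f (x \<otimes>\<^bsub>H\<^esub> y) = (\<Sum>(g, h)\<leftarrow>ts. g x * h y))"

definition linear_algebraic_group :: "('a, 'k::alg_closed_field) alg_group \<Rightarrow> bool" where
  "linear_algebraic_group H \<longleftrightarrow>
     group H \<and>
     affine_variety (carrier H) (coord H) \<and>
     (\<forall>f\<in>coord H. \<exists>ts. represents_comult H f ts) \<and>
     (\<forall>f\<in>coord H. (\<lambda>x\<in>carrier H. f (inv\<^bsub>H\<^esub> x)) \<in> coord H)"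

section \<open>The restricted Lie algebra\<close>

text \<open>
  As in the theory of distribution algebras, \<open>Lie(H)\<close> consists of the point derivations of \<open>k[H]\<close>
  at the identity. Linear functionals on \<open>k[H]\<close> are multiplied by convolution,
  \<open>\<mu> \<nu> = (\<mu> \<otimes> \<nu>) \<circ> \<Delta>\<close>; the bracket is the commutator and the \<open>[p]\<close>-mapping is the
  \<open>p\<close>-th power for this product. Functionals are extensional on \<open>k[H]\<close>.
\<close>

type_synonym ('a, 'k) functional = "('a \<Rightarrow> 'k) \<Rightarrow> 'k"

definition lie_algebra :: "('a, 'k::field) alg_group \<Rightarrow> ('a, 'k) functional set" where
  "lie_algebra H = {X \<in> extensional (coord H).
     (\<forall>c. \<forall>f\<in>coord H. X (\<lambda>x\<in>carrier H. c * f x) = c * X f) \<and>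
     (\<forall>f\<in>coord H. \<forall>g\<in>coord H. X (\<lambda>x\<in>carrier H. f x + g x) = X f + X g) \<and>
     (\<forall>f\<in>coord H. \<forall>g\<in>coord H.
        X (\<lambda>x\<in>carrier H. f x * g x) = f \<one>\<^bsub>H\<^esub> * X g + X f * g \<one>\<^bsub>H\<^esub>)}"

definition zero_fnl :: "('a, 'k::field) alg_group \<Rightarrow> ('a, 'k) functional" where
  "zero_fnl H = (\<lambda>f\<in>coord H. 0)"

definition scale_fnl ::
  "('a, 'k::field) alg_group \<Rightarrow> 'k \<Rightarrow> ('a, 'k) functional \<Rightarrow> ('a, 'k) functional" where
  "scale_fnl H s X = (\<lambda>f\<in>coord H. s * X f)"

definition convolve :: "('a, 'k::field) alg_group \<Rightarrow>
    ('a, 'k) functional \<Rightarrow> ('a, 'k) functional \<Rightarrow> ('a, 'k) functional" where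
  "convolve H \<mu> \<nu> =
     (\<lambda>f\<in>coord H. \<mu> (\<lambda>x\<in>carrier H. \<nu> (\<lambda>y\<in>carrier H. f (x \<otimes>\<^bsub>H\<^esub> y))))"

primrec conv_power ::
  "('a, 'k::field) alg_group \<Rightarrow> ('a, 'k) functional \<Rightarrow> nat \<Rightarrow> ('a, 'k) functional" where
  "conv_power H X 0 = (\<lambda>f\<in>coord H. f \<one>\<^bsub>H\<^esub>)"
| "conv_power H X (Suc n) = convolve H X (conv_power H X n)"

definition lie_bracket :: "('a, 'k::field) alg_group \<Rightarrow>
    ('a, 'k) functional \<Rightarrow> ('a, 'k) functional \<Rightarrow> ('a, 'k) functional" where
  "lie_bracket H X Y = (\<lambda>f\<in>coord H. convolve H X Y f - convolve H Y X f)"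

text \<open>\<open>Ad h\<close> is the differential at the identity of \<open>x \<mapsto> h x h\<^sup>-\<^sup>1\<close>.\<close>

definition Ad ::
  "('a, 'k::field) alg_group \<Rightarrow> 'a \<Rightarrow> ('a, 'k) functional \<Rightarrow> ('a, 'k) functional" where
  "Ad H h X = (\<lambda>f\<in>coord H. X (\<lambda>x\<in>carrier H. f (h \<otimes>\<^bsub>H\<^esub> x \<otimes>\<^bsub>H\<^esub> inv\<^bsub>H\<^esub> h)))"

definition restricted_nullcone ::
  "('a, 'k::field) alg_group \<Rightarrow> nat \<Rightarrow> ('a, 'k) functional set" where
  "restricted_nullcone H p = {X \<in> lie_algebra H. conv_power H X p = zero_fnl H}"

definition commuting_tuples ::
  "('a, 'k::field) alg_group \<Rightarrow> nat \<Rightarrow> nat \<Rightarrow> ('a, 'k) functional list set" where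
  "commuting_tuples H p r = {Xs. length Xs = r \<and> set Xs \<subseteq> restricted_nullcone H p \<and>
     (\<forall>i<r. \<forall>j<r. lie_bracket H (Xs ! i) (Xs ! j) = zero_fnl H)}"

section \<open>One-parameter subgroups and exponential maps\<close>

definition one_parameter_subgroup ::
  "('a, 'k::alg_closed_field) alg_group \<Rightarrow> ('k \<Rightarrow> 'a) \<Rightarrow> bool" where
  "one_parameter_subgroup H \<eta> \<longleftrightarrow>
     (\<forall>s. \<eta> s \<in> carrier H) \<and>
     (\<forall>s t. \<eta> (s + t) = \<eta> s \<otimes>\<^bsub>H\<^esub> \<eta> t) \<and>
     (\<forall>f\<in>coord H. \<exists>P. \<forall>s. poly P s = f (\<eta> s))"

text \<open>
  The comorphism \<open>k[H] \<rightarrow> k[t]\<close> of a one-parameter subgroup. The polynomial is unique since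
  the field is infinite.
\<close>

definition comorphism ::
  "('a, 'k::alg_closed_field) alg_group \<Rightarrow> ('k \<Rightarrow> 'a) \<Rightarrow> ('a \<Rightarrow> 'k) \<Rightarrow> 'k poly" where
  "comorphism H \<eta> = (\<lambda>f\<in>coord H. THE P. \<forall>s. poly P s = f (\<eta> s))"

definition u0 :: "'k::field poly \<Rightarrow> 'k" where
  "u0 P = coeff P 1"

definition differential :: "('a, 'k::alg_closed_field) alg_group \<Rightarrow>
    ('k \<Rightarrow> 'a) \<Rightarrow> ('k poly \<Rightarrow> 'k) \<Rightarrow> ('a, 'k) functional" where
  "differential H \<eta> \<mu> = (\<lambda>f\<in>coord H. \<mu> (comorphism H \<eta> f))"

definition exponential_map :: "('a, 'k::alg_closed_field) alg_group \<Rightarrow> nat \<Rightarrow>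
    (('a, 'k) functional \<Rightarrow> 'a) \<Rightarrow> bool" where
  "exponential_map H p \<E> \<longleftrightarrow>
     \<E> \<in> restricted_nullcone H p \<rightarrow> carrier H \<and>
     inj_on \<E> (restricted_nullcone H p) \<and>
     (\<forall>h\<in>carrier H. \<forall>X\<in>restricted_nullcone H p.
        \<E> (Ad H h X) = h \<otimes>\<^bsub>H\<^esub> \<E> X \<otimes>\<^bsub>H\<^esub> inv\<^bsub>H\<^esub> h) \<and>
     (\<forall>X\<in>restricted_nullcone H p.
        one_parameter_subgroup H (\<lambda>s. \<E> (scale_fnl H s X)) \<and>
        differential H (\<lambda>s. \<E> (scale_fnl H s X)) u0 = X \<and>
        (\<forall>s. \<forall>Y\<in>lie_algebra H. lie_bracket H X Y = zero_fnl H \<longrightarrow>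
           Ad H (\<E> (scale_fnl H s X)) Y = Y))"

section \<open>Homomorphisms from Frobenius kernels of the additive group\<close>

text \<open>
  The \<open>r\<close>-th Frobenius kernel of the additive group has coordinate ring \<open>k[t]/(t^q)\<close>,
  \<open>q = p^r\<close>, with \<open>\<Delta> t = t \<otimes> 1 + 1 \<otimes> t\<close>. Its elements are represented by the
  remainders modulo \<open>t^q\<close>.
\<close>

definition frobenius_kernel_coord :: "nat \<Rightarrow> nat \<Rightarrow> 'k::field poly set" where
  "frobenius_kernel_coord p r = {P. P mod monom 1 (p ^ r) = P}"

text \<open>Below, \<open>k poly poly\<close> is \<open>k[s][t]\<close>: \<open>lift_t P = P(t)\<close>,
  \<open>tensor_poly P Q = P(s) Q(t)\<close> and \<open>comult_poly P = P(s + t)\<close>.\<close>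

definition lift_t :: "'k::field poly \<Rightarrow> 'k poly poly" where
  "lift_t P = map_poly (\<lambda>c. [:c:]) P"

definition tensor_poly :: "'k::field poly \<Rightarrow> 'k poly \<Rightarrow> 'k poly poly" where
  "tensor_poly P Q = [:P:] * lift_t Q"

definition comult_poly :: "'k::field poly \<Rightarrow> 'k poly poly" where
  "comult_poly P = pcompose (lift_t P) [:[:0, 1:], 1:]"

text \<open>
  A homomorphism of group schemes is given by its comorphism, an algebra homomorphism
  \<open>k[H] \<rightarrow> k[t]/(t^q)\<close> compatible with the comultiplications (it then preserves counit and
  antipode). The latter is an identity in \<open>k[s,t]/(s^q,t^q)\<close>. For remainders \<open>P\<close>, \<open>Q\<close> modulo
  \<open>t^q\<close>, both \<open>P(s) Q(t)\<close> and \<open>P(s + t)\<close> are combinations of monomials \<open>s^i t^j\<close> with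
  \<open>i, j < q\<close>, which are linearly independent modulo \<open>(s^q,t^q)\<close>, so no further reduction is needed.
\<close>

definition frobenius_kernel_hom ::
  "('a, 'k::alg_closed_field) alg_group \<Rightarrow> nat \<Rightarrow> nat \<Rightarrow> (('a \<Rightarrow> 'k) \<Rightarrow> 'k poly) set" where
  "frobenius_kernel_hom H p r = {\<phi> \<in> coord H \<rightarrow>\<^sub>E frobenius_kernel_coord p r.
     (\<forall>c. \<phi> (\<lambda>x\<in>carrier H. c) = [:c:]) \<and>
     (\<forall>f\<in>coord H. \<forall>g\<in>coord H. \<phi> (\<lambda>x\<in>carrier H. f x + g x) = \<phi> f + \<phi> g) \<and>
     (\<forall>f\<in>coord H. \<forall>g\<in>coord H.
        \<phi> (\<lambda>x\<in>carrier H. f x * g x) = (\<phi> f * \<phi> g) mod monom 1 (p ^ r)) \<and>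
     (\<forall>f\<in>coord H. \<forall>ts. represents_comult H f ts \<longrightarrow>
        (\<Sum>(g, h)\<leftarrow>ts. tensor_poly (\<phi> g) (\<phi> h)) = comult_poly (\<phi> f))}"

definition restrict_to_kernel :: "('a, 'k::alg_closed_field) alg_group \<Rightarrow> nat \<Rightarrow> nat \<Rightarrow>
    ('k \<Rightarrow> 'a) \<Rightarrow> ('a \<Rightarrow> 'k) \<Rightarrow> 'k poly" where
  "restrict_to_kernel H p r \<eta> = (\<lambda>f\<in>coord H. comorphism H \<eta> f mod monom 1 (p ^ r))"

text \<open>\<open>s \<mapsto> \<E>(s X\<^sub>0) \<E>(s^p X\<^sub>1) \<cdots> \<E>(s^(p^(r-1)) X\<^sub>r\<^sub>-\<^sub>1)\<close>\<close>

definition exp_product :: "('a, 'k::alg_closed_field) alg_group \<Rightarrow> nat \<Rightarrow>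
    (('a, 'k) functional \<Rightarrow> 'a) \<Rightarrow> ('a, 'k) functional list \<Rightarrow> 'k \<Rightarrow> 'a" where
  "exp_product H p \<E> Xs s =
     foldr (\<lambda>i y. \<E> (scale_fnl H (s ^ (p ^ i)) (Xs ! i)) \<otimes>\<^bsub>H\<^esub> y) [0..<length Xs] \<one>\<^bsub>H\<^esub>"

definition exp_star :: "('a, 'k::alg_closed_field) alg_group \<Rightarrow> nat \<Rightarrow> nat \<Rightarrow>
    (('a, 'k) functional \<Rightarrow> 'a) \<Rightarrow> ('a, 'k) functional list \<Rightarrow> ('a \<Rightarrow> 'k) \<Rightarrow> 'k poly" where
  "exp_star H p r \<E> Xs = restrict_to_kernel H p r (exp_product H p \<E> Xs)"

end

theory Submission
  imports Defs
begin

text \<open>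
  Expand a homomorphism \<open>\<phi>\<close> from the Frobenius kernel in powers of \<open>t\<close>. Its coefficients
  \<open>\<phi>\<^sub>n\<close> are functionals on \<open>k[H]\<close> with \<open>\<phi>\<^sub>i \<phi>\<^sub>j = (i + j choose i) \<phi>\<^sub>i\<^sub>+\<^sub>j\<close> under convolution, so
  \<open>\<phi>\<close> is determined by the \<open>\<phi>\<^sub>n\<close> with \<open>n = p^m\<close>. Let \<open>\<psi>\<close> be the product one-parameter
  subgroup of \<open>X\<^sub>0, \<dots>, X\<^sub>m\<^sub>-\<^sub>1\<close>. Appending \<open>X\<^sub>m\<close> leaves \<open>\<psi>\<^sub>n\<close> unchanged for \<open>n < p^m\<close> and adds \<open>X\<^sub>m\<close>
  to \<open>\<psi>\<^sub>n\<close> for \<open>n = p^m\<close>, which gives injectivity. Conversely, if \<open>\<phi>\<close> and \<open>\<psi>\<close> agree below degree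
  \<open>p^m\<close>, then the difference \<open>Y\<close> of their coefficients in degree \<open>p^m\<close> is a point derivation. It
  commutes with \<open>X\<^sub>0, \<dots>, X\<^sub>m\<^sub>-\<^sub>1\<close>: inductively it is fixed by \<open>Ad\<close> of the partial product of
  \<open>X\<^sub>0, \<dots>, X\<^sub>i\<^sub>-\<^sub>1\<close>, and \<open>X\<^sub>i\<close> is the difference of two functionals that commute with \<open>Y\<close>.
  Hence \<open>Y^p = 0\<close> by the binomial theorem, and \<open>X\<^sub>m = Y\<close> extends the agreement to degree \<open>p^(m+1)\<close>.
\<close>

section \<open>Polynomials and binomial coefficients in characteristic p\<close>

text \<open>If the field were finite, adding 1 to the product of all \<open>x - a\<close> would give
  a nonconstant polynomial with constant value 1 and hence without a root.\<close>

lemma infinite_alg_closed: "infinite (UNIV :: 'k::alg_closed_field set)"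
proof
  assume fin: "finite (UNIV :: 'k set)"
  define P :: "'k poly" where "P = 1 + (\<Prod>a\<in>UNIV. [:-a, 1:])"
  have deg: "degree (\<Prod>a\<in>(UNIV::'k set). [:-a, 1:]) = card (UNIV :: 'k set)"
    by (subst degree_prod_eq_sum_degree) auto
  have "card (UNIV :: 'k set) > 0" using fin by (simp add: card_gt_0_iff)
  hence "degree P > 0"
    unfolding P_def using deg by (subst degree_add_eq_right) auto
  then obtain x where "poly P x = 0" using alg_closed_imp_poly_has_root by blast
  moreover have "poly (\<Prod>a\<in>(UNIV::'k set). [:-a, 1:]) x = 0"
    using fin by (simp add: poly_prod)
  ultimately show False by (simp add: P_def)
qed

lemma poly_eqI_alg_closed:
  fixes P Q :: "'k::alg_closed_field poly"
  assumes "\<And>s. poly P s = poly Q s"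
  shows "P = Q"
proof (rule ccontr)
  assume "P \<noteq> Q"
  hence "finite {s. poly (P - Q) s = 0}" by (intro poly_roots_finite) auto
  thus False using assms infinite_alg_closed[where 'k='k] by simp
qed

text \<open>Cutting \<open>P\<close> at degree \<open>n\<close> is its division by
  \<open>t^n\<close> with remainder, so reduction modulo \<open>t^n\<close> can be read off from
  coefficients.\<close>

lemma coeff_mod_monom:
  fixes P :: "'k::field poly"
  shows "coeff (P mod monom 1 n) i = (if i < n then coeff P i else 0)"
proof -
  have eq: "P = monom 1 n * poly_shift n P + poly_cutoff n P"
    by (intro poly_eqI) (auto simp: coeff_monom_mult coeff_poly_shift coeff_poly_cutoff)
  have "degree (poly_cutoff n P) < n \<or> poly_cutoff n P = 0"
  proof (cases "n = 0")
    case False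
    have "degree (poly_cutoff n P) \<le> n - 1"
      by (intro degree_le) (auto simp: coeff_poly_cutoff)
    with False show ?thesis by auto
  qed (auto simp: poly_eq_iff coeff_poly_cutoff)
  hence cut: "poly_cutoff n P mod monom 1 n = poly_cutoff n P"
    by (auto intro: mod_poly_less simp: degree_monom_eq)
  have "P mod monom 1 n = (monom 1 n * poly_shift n P + poly_cutoff n P) mod monom 1 n"
    using eq by simp
  also have "\<dots> = poly_cutoff n P" by (simp only: mod_mult_self4 cut)
  finally show ?thesis by (simp add: coeff_poly_cutoff)
qed

text \<open>One step of Lucas's theorem: with \<open>q = p^m\<close>, compare coefficients in
  \<open>(1 + t)^(q + b) = (1 + t^q) (1 + t)^b\<close>.\<close>

lemma of_nat_choose_add_CHAR_power:
  assumes "prime CHAR('k::field)"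
  shows "of_nat ((CHAR('k) ^ m + b) choose i) =
    (of_nat (b choose i) + (if i \<ge> CHAR('k) ^ m then of_nat (b choose (i - CHAR('k) ^ m)) else 0) :: 'k)"
proof -
  let ?q = "CHAR('k) ^ m" and ?t = "[:0, 1:] :: 'k poly"
  have lin: "coeff ([:1, 1:] ^ n) j = (of_nat (n choose j) :: 'k)" for n j
    by (cases "j \<le> n") (simp_all add: coeff_linear_poly_power binomial_eq_0 coeff_eq_0 degree_linear_power)
  have "[:1, 1:] ^ ?q = (1 + ?t) ^ ?q" by (simp add: one_pCons)
  also have "\<dots> = 1 + monom 1 ?q"
    using assms by (subst freshmans_dream'[where n = m]) (auto simp: monom_altdef)
  finally have "[:1, 1:] ^ (?q + b) = [:1, 1:] ^ b + monom 1 ?q * [:1, 1:: 'k:] ^ b"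
    by (simp add: power_add algebra_simps)
  from arg_cong[OF this, of "\<lambda>P. coeff P i"] show ?thesis
    by (auto simp: lin coeff_monom_mult)
qed

text \<open>Each further summand \<open>q = p^m\<close> adds 1 by the previous identity, and
  \<open>b choose q\<close> vanishes since \<open>b < q\<close>.\<close>

lemma of_nat_mult_add_choose_CHAR_power:
  assumes "prime CHAR('k::field)" "b < CHAR('k) ^ m"
  shows "of_nat ((a * CHAR('k) ^ m + b) choose (CHAR('k) ^ m)) = (of_nat a :: 'k)"
proof (induction a)
  case (Suc a)
  show ?case
    using of_nat_choose_add_CHAR_power[OF assms(1), of m "a * CHAR('k) ^ m + b" "CHAR('k) ^ m"] Suc
    by (simp add: add.assoc)
qed (use assms in \<open>simp add: binomial_eq_0\<close>)

text \<open>Write \<open>i + j = q + b\<close> with \<open>q = p^m\<close>. Then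
  \<open>b < i\<close> because \<open>j < q\<close>, so \<open>b choose i\<close> vanishes, and
  \<open>i < q\<close> excludes the other term. This makes truncation at \<open>t^q\<close>
  compatible with comultiplication.\<close>

lemma of_nat_choose_CHAR_power_carry:
  assumes "prime CHAR('k::field)" "i < CHAR('k) ^ m" "j < CHAR('k) ^ m" "i + j \<ge> CHAR('k) ^ m"
  shows "of_nat ((i + j) choose i) = (0 :: 'k)"
proof -
  have "i + j = CHAR('k) ^ m + (i + j - CHAR('k) ^ m)" using assms by simp
  thus ?thesis
    using of_nat_choose_add_CHAR_power[OF assms(1), of m "i + j - CHAR('k) ^ m" i] assms
    by (simp add: binomial_eq_0)
qed

section \<open>Polynomials in two variables and comultiplication\<close>

lemma coeff_lift_t: "coeff (lift_t P) i = [:coeff P i:]"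
  by (simp add: lift_t_def coeff_map_poly)

lemma lift_t_pCons: "lift_t (pCons a P) = pCons [:a:] (lift_t P)"
  by (simp add: lift_t_def map_poly_pCons)

lemma poly_tensor_poly: "poly (poly (tensor_poly P Q) [:t:]) s = poly P s * poly Q t"
proof -
  have "poly (poly (lift_t Q) [:t:]) s = poly Q t"
    by (induction Q) (simp_all add: lift_t_pCons, simp add: lift_t_def)
  thus ?thesis by (simp add: tensor_poly_def)
qed

lemma poly_comult_poly: "poly (poly (comult_poly P) [:t:]) s = poly P (s + t)"
  by (induction P)
    (simp_all add: comult_poly_def lift_t_pCons pcompose_pCons algebra_simps, simp add: lift_t_def)

text \<open>The difference is a polynomial in \<open>t\<close> over the domain \<open>k[s]\<close>
  that vanishes at all constants \<open>[:t:]\<close>, of which there are infinitely many.\<close>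

lemma poly_poly_eqI_alg_closed:
  fixes P Q :: "'k::alg_closed_field poly poly"
  assumes "\<And>s t. poly (poly P [:t:]) s = poly (poly Q [:t:]) s"
  shows "P = Q"
proof (rule ccontr)
  assume "P \<noteq> Q"
  hence "finite {u. poly (P - Q) u = 0}" by (intro poly_roots_finite) auto
  moreover have "range (\<lambda>t. [:t:]) \<subseteq> {u. poly (P - Q) u = 0}"
    using assms by (auto intro: poly_eqI_alg_closed)
  ultimately have "finite (range (\<lambda>t::'k. [:t:]))" by (rule rev_finite_subset)
  hence "finite (UNIV :: 'k set)" by (rule finite_imageD) (auto simp: inj_on_def)
  thus False using infinite_alg_closed by blast
qed

lemma coeff_tensor_poly: "coeff (coeff (tensor_poly P Q) j) i = coeff P i * coeff Q j"
  by (simp add: tensor_poly_def coeff_lift_t)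

text \<open>The outer variable is \<open>t\<close> and the inner one \<open>s\<close>, so this is
  the coefficient of \<open>s^i t^j\<close> in \<open>P(s + t)\<close>, given by the binomial
  theorem.\<close>

lemma coeff_comult_poly:
  "coeff (coeff (comult_poly P) j) i = of_nat ((i + j) choose i) * coeff P (i + j)"
proof -
  have mon: "coeff (coeff ([:[:0, 1:], 1:] ^ n) j) i =
      (if n = i + j then of_nat (n choose i) else (0::'a))" for n
  proof (cases "j \<le> n")
    case True
    have "coeff ([:[:0, 1:], 1:] ^ n) j = of_nat (n choose j) * [:0, 1::'a:] ^ (n - j)"
      using True by (simp add: coeff_linear_poly_power)
    also have "\<dots> = monom (of_nat (n choose j)) (n - j)"
      by (simp add: of_nat_poly monom_altdef)
    finally show ?thesis using True by (auto simp: binomial_symmetric[of j n])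
  next
    case False
    have "degree ([:[:0, 1:], 1::'a poly:] ^ n) \<le> n"
      using degree_power_le[of "[:[:0, 1:], 1::'a poly:]" n] by simp
    with False show ?thesis by (simp add: coeff_eq_0)
  qed
  have "comult_poly P = (\<Sum>n\<le>degree P. [:[:coeff P n:]:] * [:[:0, 1:], 1:] ^ n)"
  proof -
    have "comult_poly P = poly (map_poly (\<lambda>x. [:x:]) (lift_t P)) [:[:0, 1:], 1:]"
      by (simp add: comult_poly_def pcompose_altdef)
    also have "map_poly (\<lambda>x. [:x:]) (lift_t P) = map_poly (\<lambda>x. [:[:x:]:]) P"
      by (intro poly_eqI) (simp add: lift_t_def coeff_map_poly)
    finally show ?thesis by (simp add: poly_altdef degree_map_poly coeff_map_poly)
  qed
  hence "coeff (coeff (comult_poly P) j) i =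
      (\<Sum>n\<le>degree P. coeff P n * (if n = i + j then of_nat (n choose i) else 0))"
    by (simp add: coeff_sum mon)
  also have "\<dots> = of_nat ((i + j) choose i) * coeff P (i + j)"
    by (simp add: if_distrib sum.delta coeff_eq_0 cong: if_cong)
  finally show ?thesis .
qed

lemma coeff_pcompose_monom:
  fixes P :: "'k::comm_ring_1 poly"
  assumes "q > 0"
  shows "coeff (pcompose P (monom 1 q)) n = (if q dvd n then coeff P (n div q) else 0)"
proof (induction P arbitrary: n)
  case (pCons a P)
  have dvd: "q dvd n \<longleftrightarrow> q dvd n - q" if "n \<ge> q" using that by (simp add: dvd_minus_self)
  have "n div q = Suc ((n - q) div q)" if "n \<ge> q" using le_div_geq[OF assms that] .
  moreover have "q dvd n \<Longrightarrow> n < q \<Longrightarrow> n = 0" by (auto dest: nat_dvd_not_less)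
  ultimately show ?case
    using assms by (auto simp: pcompose_pCons coeff_monom_mult pCons.IH coeff_pCons dvd split: nat.splits)
qed simp

lemma poly_sum_list: "poly (\<Sum>u\<leftarrow>us. P u) s = (\<Sum>u\<leftarrow>us. poly (P u) s)"
  by (induction us) simp_all

lemma coeff_sum_list: "coeff (\<Sum>u\<leftarrow>us. P u) n = (\<Sum>u\<leftarrow>us. coeff (P u) n)"
  by (induction us) simp_all

section \<open>Convolution of linear functionals\<close>

locale linear_alg_group =
  fixes H :: "('a, 'k::alg_closed_field) alg_group" (structure)
  assumes linear_algebraic_group: "linear_algebraic_group H"
begin

sublocale group H
  using linear_algebraic_group by (simp add: linear_algebraic_group_def)

lemma function_algebra: "function_algebra (carrier H) (coord H)"
  using linear_algebraic_group by (simp add: linear_algebraic_group_def affine_variety_def)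

lemma coord_const: "(\<lambda>x\<in>carrier H. c) \<in> coord H"
  and coord_add: "f \<in> coord H \<Longrightarrow> g \<in> coord H \<Longrightarrow> (\<lambda>x\<in>carrier H. f x + g x) \<in> coord H"
  and coord_mult: "f \<in> coord H \<Longrightarrow> g \<in> coord H \<Longrightarrow> (\<lambda>x\<in>carrier H. f x * g x) \<in> coord H"
  and coord_extensional: "f \<in> coord H \<Longrightarrow> f \<in> extensional (carrier H)"
  using function_algebra by (auto simp: function_algebra_def)

lemma coord_scale: "f \<in> coord H \<Longrightarrow> (\<lambda>x\<in>carrier H. c * f x) \<in> coord H"
proof -
  assume "f \<in> coord H"
  hence "(\<lambda>x\<in>carrier H. (\<lambda>x\<in>carrier H. c) x * f x) \<in> coord H"
    by (intro coord_mult coord_const)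
  also have "(\<lambda>x\<in>carrier H. (\<lambda>x\<in>carrier H. c) x * f x) = (\<lambda>x\<in>carrier H. c * f x)"
    by (intro restrict_ext) simp
  finally show ?thesis .
qed

lemma coord_sum_list:
  assumes "\<And>u. u \<in> set us \<Longrightarrow> F u \<in> coord H"
  shows "(\<lambda>x\<in>carrier H. \<Sum>u\<leftarrow>us. w u * F u x) \<in> coord H"
  using assms
proof (induction us)
  case Nil
  show ?case using coord_const[of 0] by (simp only: list.map sum_list.Nil)
next
  case (Cons u us)
  have "(\<lambda>x\<in>carrier H. (\<lambda>x\<in>carrier H. w u * F u x) x +
      (\<lambda>x\<in>carrier H. \<Sum>u\<leftarrow>us. w u * F u x) x) \<in> coord H"
    using Cons by (intro coord_add coord_scale) auto
  also have "(\<lambda>x\<in>carrier H. (\<lambda>x\<in>carrier H. w u * F u x) x +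
      (\<lambda>x\<in>carrier H. \<Sum>u\<leftarrow>us. w u * F u x) x) = (\<lambda>x\<in>carrier H. \<Sum>u\<leftarrow>u # us. w u * F u x)"
    by (intro restrict_ext) simp
  finally show ?case .
qed

lemma obtain_comult:
  assumes "f \<in> coord H"
  obtains ts where "represents_comult H f ts"
  using linear_algebraic_group assms by (auto simp: linear_algebraic_group_def)

lemma represents_comultD:
  assumes "represents_comult H f ts"
  shows "u \<in> set ts \<Longrightarrow> fst u \<in> coord H" "u \<in> set ts \<Longrightarrow> snd u \<in> coord H"
    and "x \<in> carrier H \<Longrightarrow> y \<in> carrier H \<Longrightarrow> f (x \<otimes> y) = (\<Sum>u\<leftarrow>ts. fst u x * snd u y)"
  using assms by (auto simp: represents_comult_def case_prod_unfold)

lemma coord_translate_left: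
  assumes "f \<in> coord H" "x \<in> carrier H"
  shows "(\<lambda>y\<in>carrier H. f (x \<otimes> y)) \<in> coord H"
proof -
  obtain ts where comult: "represents_comult H f ts"
    using obtain_comult[OF assms(1)] .
  note ts = represents_comultD[OF comult]
  have "(\<lambda>y\<in>carrier H. f (x \<otimes> y)) = (\<lambda>y\<in>carrier H. \<Sum>u\<leftarrow>ts. fst u x * snd u y)"
    using ts(3) assms(2) by (intro restrict_ext) auto
  thus ?thesis using coord_sum_list[of ts snd "\<lambda>u. fst u x"] ts(2) by simp
qed

lemma coord_translate_right:
  assumes "f \<in> coord H" "y \<in> carrier H"
  shows "(\<lambda>x\<in>carrier H. f (x \<otimes> y)) \<in> coord H"
proof -
  obtain ts where comult: "represents_comult H f ts"
    using obtain_comult[OF assms(1)] .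
  note ts = represents_comultD[OF comult]
  have "(\<lambda>x\<in>carrier H. f (x \<otimes> y)) = (\<lambda>x\<in>carrier H. \<Sum>u\<leftarrow>ts. snd u y * fst u x)"
    using ts(3) assms(2) by (intro restrict_ext) (simp add: mult.commute)
  thus ?thesis using coord_sum_list[of ts fst "\<lambda>u. snd u y"] ts(1) by simp
qed

text \<open>Evaluation at \<open>x\<close> is a character of the coordinate algebra, and an affine
  variety has exactly one point for each character.\<close>

lemma eq_if_coord_eq:
  assumes "x \<in> carrier H" "y \<in> carrier H" "\<And>f. f \<in> coord H \<Longrightarrow> f x = f y"
  shows "x = y"
proof -
  have "algebra_character (carrier H) (coord H) (\<lambda>f. f x)"
    using assms(1) by (simp add: algebra_character_def)
  hence "\<exists>!z. z \<in> carrier H \<and> (\<forall>f\<in>coord H. f x = f z)"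
    using linear_algebraic_group by (auto simp: linear_algebraic_group_def affine_variety_def)
  thus ?thesis using assms by blast
qed

text \<open>The full linear dual of \<open>k[H]\<close>. It contains the point derivations, the
  evaluations at points and the coefficients of comorphisms, and convolution makes it an associative
  algebra.\<close>

definition linear_fnls :: "('a, 'k) functional set" where
  "linear_fnls = {\<mu> \<in> extensional (coord H).
     (\<forall>c. \<forall>f\<in>coord H. \<mu> (\<lambda>x\<in>carrier H. c * f x) = c * \<mu> f) \<and>
     (\<forall>f\<in>coord H. \<forall>g\<in>coord H. \<mu> (\<lambda>x\<in>carrier H. f x + g x) = \<mu> f + \<mu> g)}"

lemma linear_fnls_scale:
    "\<mu> \<in> linear_fnls \<Longrightarrow> f \<in> coord H \<Longrightarrow> \<mu> (\<lambda>x\<in>carrier H. c * f x) = c * \<mu> f"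
  and linear_fnls_add: "\<mu> \<in> linear_fnls \<Longrightarrow> f \<in> coord H \<Longrightarrow> g \<in> coord H \<Longrightarrow>
    \<mu> (\<lambda>x\<in>carrier H. f x + g x) = \<mu> f + \<mu> g"
  and linear_fnls_extensional: "\<mu> \<in> linear_fnls \<Longrightarrow> \<mu> \<in> extensional (coord H)"
  by (auto simp: linear_fnls_def)

lemma fnl_eqI:
  assumes "\<mu> \<in> extensional (coord H)" "\<nu> \<in> extensional (coord H)"
    and "\<And>f. f \<in> coord H \<Longrightarrow> \<mu> f = \<nu> f"
  shows "\<mu> = \<nu>"
  using assms by (rule extensionalityI)

lemma lie_algebra_linear: "X \<in> lie_algebra H \<Longrightarrow> X \<in> linear_fnls"
  by (auto simp: lie_algebra_def linear_fnls_def)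

lemma linear_fnls_sum_list:
  assumes "\<mu> \<in> linear_fnls" "\<And>u. u \<in> set us \<Longrightarrow> F u \<in> coord H"
  shows "\<mu> (\<lambda>x\<in>carrier H. \<Sum>u\<leftarrow>us. w u * F u x) = (\<Sum>u\<leftarrow>us. w u * \<mu> (F u))"
  using assms(2)
proof (induction us)
  case Nil
  show ?case using linear_fnls_scale[OF assms(1) coord_const, of 0 0]
    by (simp only: list.map sum_list.Nil mult_zero_left)
next
  case (Cons u us)
  have "(\<lambda>x\<in>carrier H. \<Sum>u\<leftarrow>u # us. w u * F u x) =
      (\<lambda>x\<in>carrier H. (\<lambda>x\<in>carrier H. w u * F u x) x + (\<lambda>x\<in>carrier H. \<Sum>u\<leftarrow>us. w u * F u x) x)"
    by (intro restrict_ext) simp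
  hence "\<mu> (\<lambda>x\<in>carrier H. \<Sum>u\<leftarrow>u # us. w u * F u x) = \<mu> \<dots>"
    by (rule arg_cong)
  also have "\<dots> = \<mu> (\<lambda>x\<in>carrier H. w u * F u x) + \<mu> (\<lambda>x\<in>carrier H. \<Sum>u\<leftarrow>us. w u * F u x)"
    by (rule linear_fnls_add[OF assms(1)]; rule coord_scale coord_sum_list) (simp_all add: Cons.prems)
  also have "\<dots> = w u * \<mu> (F u) + (\<Sum>u\<leftarrow>us. w u * \<mu> (F u))"
    using Cons by (simp only: linear_fnls_scale[OF assms(1)] list.set_intros)
  finally show ?case by (simp only: list.map sum_list.Cons)
qed

text \<open>The operator \<open>(id \<otimes> \<nu>) \<circ> \<Delta>\<close> on
  \<open>k[H]\<close>, through which convolution by \<open>\<nu>\<close> from the right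
  factors.\<close>

definition conv_op :: "('a, 'k) functional \<Rightarrow> ('a \<Rightarrow> 'k) \<Rightarrow> 'a \<Rightarrow> 'k" where
  "conv_op \<nu> f = (\<lambda>x\<in>carrier H. \<nu> (\<lambda>y\<in>carrier H. f (x \<otimes> y)))"

lemma convolve_apply: "f \<in> coord H \<Longrightarrow> convolve H \<mu> \<nu> f = \<mu> (conv_op \<nu> f)"
  by (simp add: convolve_def conv_op_def)

text \<open>For fixed \<open>x\<close> the function under \<open>\<nu>\<close> is a finite
  combination of the regular functions \<open>snd u\<close>, so linearity of \<open>\<nu>\<close>
  applies. In particular the operator preserves \<open>coord H\<close>.\<close>

lemma conv_op_comult:
  assumes "\<nu> \<in> linear_fnls" "represents_comult H f ts"
  shows "conv_op \<nu> f = (\<lambda>x\<in>carrier H. \<Sum>u\<leftarrow>ts. \<nu> (snd u) * fst u x)"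
proof -
  have "\<nu> (\<lambda>y\<in>carrier H. f (x \<otimes> y)) = (\<Sum>u\<leftarrow>ts. \<nu> (snd u) * fst u x)" if x: "x \<in> carrier H" for x
  proof -
    have "(\<lambda>y\<in>carrier H. f (x \<otimes> y)) = (\<lambda>y\<in>carrier H. \<Sum>u\<leftarrow>ts. fst u x * snd u y)"
      using assms(2) x by (auto simp: represents_comult_def case_prod_unfold intro!: restrict_ext)
    moreover have "\<And>u. u \<in> set ts \<Longrightarrow> snd u \<in> coord H"
      using assms(2) by (auto simp: represents_comult_def)
    ultimately have "\<nu> (\<lambda>y\<in>carrier H. f (x \<otimes> y)) = (\<Sum>u\<leftarrow>ts. fst u x * \<nu> (snd u))"
      using linear_fnls_sum_list[OF assms(1), of ts snd "\<lambda>u. fst u x"] by simp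
    thus ?thesis by (simp add: mult.commute)
  qed
  thus ?thesis by (auto simp: conv_op_def intro!: restrict_ext)
qed

lemma coord_conv_op:
  assumes "\<nu> \<in> linear_fnls" "f \<in> coord H"
  shows "conv_op \<nu> f \<in> coord H"
proof -
  obtain ts where comult: "represents_comult H f ts"
    using obtain_comult[OF assms(2)] .
  note ts = represents_comultD[OF comult]
  show ?thesis using assms comult ts by (simp add: conv_op_comult coord_sum_list)
qed

text \<open>The formula \<open>(\<mu> \<otimes> \<nu>) \<circ> \<Delta>\<close> treats both factors
  symmetrically; linearity in the right factor is proved through it.\<close>

lemma convolve_comult:
  assumes "\<mu> \<in> linear_fnls" "\<nu> \<in> linear_fnls" "f \<in> coord H" "represents_comult H f ts"
  shows "convolve H \<mu> \<nu> f = (\<Sum>u\<leftarrow>ts. \<mu> (fst u) * \<nu> (snd u))"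
proof -
  have "\<And>u. u \<in> set ts \<Longrightarrow> fst u \<in> coord H" using assms(4) by (auto simp: represents_comult_def)
  hence "convolve H \<mu> \<nu> f = (\<Sum>u\<leftarrow>ts. \<nu> (snd u) * \<mu> (fst u))"
    using assms linear_fnls_sum_list[OF assms(1), of ts fst "\<lambda>u. \<nu> (snd u)"]
    by (simp add: convolve_apply conv_op_comult)
  thus ?thesis by (simp add: mult.commute)
qed

lemma convolve_linear:
  assumes "\<mu> \<in> linear_fnls" "\<nu> \<in> linear_fnls"
  shows "convolve H \<mu> \<nu> \<in> linear_fnls"
proof -
  have "conv_op \<nu> (\<lambda>x\<in>carrier H. c * f x) = (\<lambda>x\<in>carrier H. c * conv_op \<nu> f x)"
    if "f \<in> coord H" for c f
    unfolding conv_op_def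
  proof (rule restrict_ext)
    fix x assume x: "x \<in> carrier H"
    show "\<nu> (\<lambda>y\<in>carrier H. (\<lambda>x\<in>carrier H. c * f x) (x \<otimes> y)) =
        c * (\<lambda>x\<in>carrier H. \<nu> (\<lambda>y\<in>carrier H. f (x \<otimes> y))) x"
    proof -
      have "(\<lambda>y\<in>carrier H. (\<lambda>x\<in>carrier H. c * f x) (x \<otimes> y)) =
          (\<lambda>y\<in>carrier H. c * (\<lambda>y\<in>carrier H. f (x \<otimes> y)) y)"
        using x by (intro restrict_ext) simp
      thus ?thesis
        using linear_fnls_scale[OF assms(2) coord_translate_left[OF that x], of c] x by simp
    qed
  qed
  moreover have "conv_op \<nu> (\<lambda>x\<in>carrier H. f x + g x) =
      (\<lambda>x\<in>carrier H. conv_op \<nu> f x + conv_op \<nu> g x)"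
    if "f \<in> coord H" "g \<in> coord H" for f g
    unfolding conv_op_def
  proof (rule restrict_ext)
    fix x assume x: "x \<in> carrier H"
    show "\<nu> (\<lambda>y\<in>carrier H. (\<lambda>x\<in>carrier H. f x + g x) (x \<otimes> y)) =
        (\<lambda>x\<in>carrier H. \<nu> (\<lambda>y\<in>carrier H. f (x \<otimes> y))) x +
        (\<lambda>x\<in>carrier H. \<nu> (\<lambda>y\<in>carrier H. g (x \<otimes> y))) x"
    proof -
      have "(\<lambda>y\<in>carrier H. (\<lambda>x\<in>carrier H. f x + g x) (x \<otimes> y)) =
          (\<lambda>y\<in>carrier H. (\<lambda>y\<in>carrier H. f (x \<otimes> y)) y + (\<lambda>y\<in>carrier H. g (x \<otimes> y)) y)"
        using x by (intro restrict_ext) simp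
      thus ?thesis
        using linear_fnls_add[OF assms(2) coord_translate_left[OF that(1) x]
            coord_translate_left[OF that(2) x]] x by simp
    qed
  qed
  ultimately show ?thesis
    using assms(1) coord_conv_op[OF assms(2)]
    by (simp add: linear_fnls_def convolve_apply coord_scale coord_add)
      (simp add: convolve_def)
qed

text \<open>\<open>conv_op \<rho>\<close> commutes with left translations by associativity of the
  group. Hence applying it and then \<open>conv_op \<nu>\<close> is the operator of
  \<open>convolve H \<nu> \<rho>\<close>.\<close>

lemma convolve_assoc:
  assumes "\<nu> \<in> linear_fnls" "\<rho> \<in> linear_fnls"
  shows "convolve H (convolve H \<mu> \<nu>) \<rho> = convolve H \<mu> (convolve H \<nu> \<rho>)"
proof (rule fnl_eqI)
  fix f assume f: "f \<in> coord H"
  have "conv_op \<nu> (conv_op \<rho> f) = conv_op (convolve H \<nu> \<rho>) f"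
    unfolding conv_op_def[of \<nu>] conv_op_def[of "convolve H \<nu> \<rho>"]
  proof (rule restrict_ext)
    fix x assume x: "x \<in> carrier H"
    have "(\<lambda>y\<in>carrier H. conv_op \<rho> f (x \<otimes> y)) = conv_op \<rho> (\<lambda>w\<in>carrier H. f (x \<otimes> w))"
      unfolding conv_op_def
    proof (rule restrict_ext)
      fix y assume y: "y \<in> carrier H"
      have "(\<lambda>z\<in>carrier H. f (x \<otimes> y \<otimes> z)) = (\<lambda>z\<in>carrier H. (\<lambda>w\<in>carrier H. f (x \<otimes> w)) (y \<otimes> z))"
        using x y by (intro restrict_ext) (simp add: m_assoc)
      thus "(\<lambda>x\<in>carrier H. \<rho> (\<lambda>y\<in>carrier H. f (x \<otimes> y))) (x \<otimes> y) =
          \<rho> (\<lambda>z\<in>carrier H. (\<lambda>w\<in>carrier H. f (x \<otimes> w)) (y \<otimes> z))"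
        using x y by simp
    qed
    thus "\<nu> (\<lambda>y\<in>carrier H. conv_op \<rho> f (x \<otimes> y)) =
        convolve H \<nu> \<rho> (\<lambda>y\<in>carrier H. f (x \<otimes> y))"
      using coord_translate_left[OF f x] by (simp add: convolve_apply)
  qed
  thus "convolve H (convolve H \<mu> \<nu>) \<rho> f = convolve H \<mu> (convolve H \<nu> \<rho>) f"
    using f assms by (simp add: convolve_apply coord_conv_op)
qed (simp_all add: convolve_def)

text \<open>Embeds the group into the dual algebra: products of points become convolutions, and the
  identity becomes the unit.\<close>

definition point_eval :: "'a \<Rightarrow> ('a, 'k) functional" where
  "point_eval x = (\<lambda>f\<in>coord H. f x)"

lemma point_eval_linear: "x \<in> carrier H \<Longrightarrow> point_eval x \<in> linear_fnls"
  by (simp add: point_eval_def linear_fnls_def coord_scale coord_add)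

lemma conv_power_0: "conv_power H X 0 = point_eval \<one>"
  by (simp add: point_eval_def)

lemma convolve_point_eval_left:
  assumes "x \<in> carrier H" "\<mu> \<in> linear_fnls" "f \<in> coord H"
  shows "convolve H (point_eval x) \<mu> f = \<mu> (\<lambda>y\<in>carrier H. f (x \<otimes> y))"
  using assms coord_conv_op[of \<mu> f] by (simp add: convolve_apply point_eval_def) (simp add: conv_op_def)

lemma convolve_point_eval_right:
  assumes "x \<in> carrier H" "f \<in> coord H"
  shows "convolve H \<mu> (point_eval x) f = \<mu> (\<lambda>y\<in>carrier H. f (y \<otimes> x))"
proof -
  have "conv_op (point_eval x) f = (\<lambda>y\<in>carrier H. f (y \<otimes> x))"
    using assms coord_translate_left[OF assms(2)]
    by (auto simp: conv_op_def point_eval_def intro!: restrict_ext)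
  thus ?thesis using assms by (simp add: convolve_apply)
qed

lemma convolve_one_left:
  assumes "\<mu> \<in> linear_fnls" shows "convolve H (point_eval \<one>) \<mu> = \<mu>"
proof (rule fnl_eqI)
  fix f assume "f \<in> coord H"
  moreover from this have "(\<lambda>y\<in>carrier H. f (\<one> \<otimes> y)) = f"
    by (intro extensionalityI[of _ "carrier H"]) (auto intro: coord_extensional)
  ultimately show "convolve H (point_eval \<one>) \<mu> f = \<mu> f"
    using assms by (simp add: convolve_point_eval_left)
qed (use assms in \<open>simp_all add: convolve_def linear_fnls_extensional\<close>)

lemma convolve_one_right:
  assumes "\<mu> \<in> linear_fnls" shows "convolve H \<mu> (point_eval \<one>) = \<mu>"
proof (rule fnl_eqI)
  fix f assume "f \<in> coord H"
  moreover from this have "(\<lambda>y\<in>carrier H. f (y \<otimes> \<one>)) = f"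
    by (intro extensionalityI[of _ "carrier H"]) (auto intro: coord_extensional)
  ultimately show "convolve H \<mu> (point_eval \<one>) f = \<mu> f"
    using assms by (simp add: convolve_point_eval_right)
qed (use assms in \<open>simp_all add: convolve_def linear_fnls_extensional\<close>)

lemma convolve_point_eval:
  assumes "x \<in> carrier H" "y \<in> carrier H"
  shows "convolve H (point_eval x) (point_eval y) = point_eval (x \<otimes> y)"
proof (rule fnl_eqI)
  fix f assume "f \<in> coord H"
  thus "convolve H (point_eval x) (point_eval y) f = point_eval (x \<otimes> y) f"
    using assms coord_translate_right[of f y]
    by (simp add: convolve_point_eval_right) (simp add: point_eval_def)
qed (simp_all add: convolve_def point_eval_def)

lemma conv_power_linear: "\<mu> \<in> linear_fnls \<Longrightarrow> conv_power H \<mu> n \<in> linear_fnls"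
  by (induction n) (auto simp: conv_power_0 point_eval_linear convolve_linear simp del: conv_power.simps(1))

section \<open>Sums and scalar multiples of functionals\<close>

lemma scale_fnl_linear: "\<mu> \<in> linear_fnls \<Longrightarrow> scale_fnl H c \<mu> \<in> linear_fnls"
  by (simp add: scale_fnl_def linear_fnls_def coord_scale coord_add algebra_simps)

definition add_fnl :: "('a, 'k) functional \<Rightarrow> ('a, 'k) functional \<Rightarrow> ('a, 'k) functional" where
  "add_fnl \<mu> \<nu> = (\<lambda>f\<in>coord H. \<mu> f + \<nu> f)"

lemma add_fnl_apply: "f \<in> coord H \<Longrightarrow> add_fnl \<mu> \<nu> f = \<mu> f + \<nu> f"
  by (simp add: add_fnl_def)

lemma add_fnl_linear: "\<mu> \<in> linear_fnls \<Longrightarrow> \<nu> \<in> linear_fnls \<Longrightarrow> add_fnl \<mu> \<nu> \<in> linear_fnls"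
  by (simp add: add_fnl_def linear_fnls_def coord_scale coord_add algebra_simps)

lemma convolve_scale_left:
  assumes "\<nu> \<in> linear_fnls"
  shows "convolve H (scale_fnl H c \<mu>) \<nu> = scale_fnl H c (convolve H \<mu> \<nu>)"
proof (rule fnl_eqI)
  fix f assume "f \<in> coord H"
  thus "convolve H (scale_fnl H c \<mu>) \<nu> f = scale_fnl H c (convolve H \<mu> \<nu>) f"
    using assms by (simp add: convolve_apply scale_fnl_def coord_conv_op)
qed (simp_all add: convolve_def scale_fnl_def)

lemma convolve_scale_right:
  assumes "\<mu> \<in> linear_fnls" "\<nu> \<in> linear_fnls"
  shows "convolve H \<mu> (scale_fnl H c \<nu>) = scale_fnl H c (convolve H \<mu> \<nu>)"
proof (rule fnl_eqI)
  fix f assume f: "f \<in> coord H"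
  obtain ts where comult: "represents_comult H f ts"
    using obtain_comult[OF f] .
  note ts = represents_comultD[OF comult]
  show "convolve H \<mu> (scale_fnl H c \<nu>) f = scale_fnl H c (convolve H \<mu> \<nu>) f"
    using assms f ts by (simp add: convolve_comult[OF _ _ f comult] scale_fnl_linear)
      (simp add: scale_fnl_def convolve_comult[OF _ _ f comult] sum_list_const_mult[symmetric]
         mult.left_commute cong: map_cong)
qed (simp_all add: convolve_def scale_fnl_def)

lemma convolve_add_left:
  assumes "\<rho> \<in> linear_fnls"
  shows "convolve H (add_fnl \<mu> \<nu>) \<rho> = add_fnl (convolve H \<mu> \<rho>) (convolve H \<nu> \<rho>)"
proof (rule fnl_eqI)
  fix f assume "f \<in> coord H"
  thus "convolve H (add_fnl \<mu> \<nu>) \<rho> f = add_fnl (convolve H \<mu> \<rho>) (convolve H \<nu> \<rho>) f"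
    using assms by (simp add: convolve_apply add_fnl_def coord_conv_op)
qed (simp_all add: convolve_def add_fnl_def)

lemma convolve_add_right:
  assumes "\<mu> \<in> linear_fnls" "\<nu> \<in> linear_fnls" "\<rho> \<in> linear_fnls"
  shows "convolve H \<rho> (add_fnl \<mu> \<nu>) = add_fnl (convolve H \<rho> \<mu>) (convolve H \<rho> \<nu>)"
proof (rule fnl_eqI)
  fix f assume f: "f \<in> coord H"
  obtain ts where comult: "represents_comult H f ts"
    using obtain_comult[OF f] .
  note ts = represents_comultD[OF comult]
  show "convolve H \<rho> (add_fnl \<mu> \<nu>) f = add_fnl (convolve H \<rho> \<mu>) (convolve H \<rho> \<nu>) f"
    using assms f ts by (simp add: convolve_comult[OF _ _ f comult] add_fnl_linear)
      (simp add: add_fnl_def convolve_comult[OF _ _ f comult] sum_list_addf[symmetric]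
         distrib_left cong: map_cong)
qed (simp_all add: convolve_def add_fnl_def)

section \<open>Commuting functionals and their powers\<close>

definition commute :: "('a, 'k) functional \<Rightarrow> ('a, 'k) functional \<Rightarrow> bool" where
  "commute \<mu> \<nu> \<longleftrightarrow> convolve H \<mu> \<nu> = convolve H \<nu> \<mu>"

lemma zero_fnl_eq_scale: "zero_fnl H = scale_fnl H 0 (point_eval \<one>)"
  by (auto simp: zero_fnl_def scale_fnl_def)

lemma zero_fnl_apply: "f \<in> coord H \<Longrightarrow> zero_fnl H f = 0"
  by (simp add: zero_fnl_def)

lemma convolve_zero:
  assumes "\<rho> \<in> linear_fnls"
  shows "convolve H (zero_fnl H) \<rho> = zero_fnl H" "convolve H \<rho> (zero_fnl H) = zero_fnl H"
  unfolding zero_fnl_eq_scale using assms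
  by (simp_all add: convolve_scale_left convolve_scale_right point_eval_linear)
    (simp_all add: scale_fnl_def)

lemma commute_sym: "commute \<mu> \<nu> \<Longrightarrow> commute \<nu> \<mu>"
  by (simp add: commute_def)

lemma lie_bracket_eq_zero_iff: "lie_bracket H X Y = zero_fnl H \<longleftrightarrow> commute X Y"
proof
  assume eq: "lie_bracket H X Y = zero_fnl H"
  have "convolve H X Y f = convolve H Y X f" if "f \<in> coord H" for f
    using fun_cong[OF eq, of f] that by (simp add: lie_bracket_def zero_fnl_def)
  thus "commute X Y" unfolding commute_def by (intro fnl_eqI) (simp_all add: convolve_def)
qed (auto simp: commute_def lie_bracket_def zero_fnl_def)

lemma commute_add:
  "\<mu> \<in> linear_fnls \<Longrightarrow> \<nu> \<in> linear_fnls \<Longrightarrow> \<rho> \<in> linear_fnls \<Longrightarrow>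
    commute \<rho> \<mu> \<Longrightarrow> commute \<rho> \<nu> \<Longrightarrow> commute \<rho> (add_fnl \<mu> \<nu>)"
  by (simp add: commute_def convolve_add_left convolve_add_right)

lemma commute_scale:
  "\<mu> \<in> linear_fnls \<Longrightarrow> \<rho> \<in> linear_fnls \<Longrightarrow> commute \<rho> \<mu> \<Longrightarrow> commute \<rho> (scale_fnl H c \<mu>)"
  by (simp add: commute_def convolve_scale_left convolve_scale_right)

lemma commute_convolve:
  assumes "\<mu> \<in> linear_fnls" "\<nu> \<in> linear_fnls" "\<rho> \<in> linear_fnls" "commute \<rho> \<mu>" "commute \<rho> \<nu>"
  shows "commute \<rho> (convolve H \<mu> \<nu>)"
  using assms by (simp add: commute_def) (metis convolve_assoc)

lemma commute_conv_power:
  assumes "\<mu> \<in> linear_fnls" "\<rho> \<in> linear_fnls" "commute \<rho> \<mu>"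
  shows "commute \<rho> (conv_power H \<mu> n)"
proof (induction n)
  case 0
  show ?case using assms
    by (simp add: conv_power_0 commute_def convolve_one_left convolve_one_right del: conv_power.simps(1))
qed (use assms in \<open>simp add: commute_convolve conv_power_linear\<close>)

lemma conv_power_scale:
  assumes "\<mu> \<in> linear_fnls"
  shows "conv_power H (scale_fnl H c \<mu>) n = scale_fnl H (c ^ n) (conv_power H \<mu> n)"
proof (induction n)
  case (Suc n)
  thus ?case using assms
    by (simp add: convolve_scale_left convolve_scale_right scale_fnl_linear conv_power_linear)
      (auto simp: scale_fnl_def)
qed (auto simp: scale_fnl_def)

text \<open>The binomial theorem for commuting functionals, evaluated at \<open>f\<close>. The
  induction lets \<open>f\<close> vary because a convolution step passes to the second tensor
  factors of its comultiplication.\<close>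

lemma conv_power_add:
  assumes "\<mu> \<in> linear_fnls" "\<nu> \<in> linear_fnls" "commute \<mu> \<nu>" "f \<in> coord H"
  shows "conv_power H (add_fnl \<mu> \<nu>) n f =
    (\<Sum>k\<le>n. of_nat (n choose k) * convolve H (conv_power H \<mu> k) (conv_power H \<nu> (n - k)) f)"
  using assms(4)
proof (induction n arbitrary: f)
  case 0
  show ?case
    using 0 by (simp add: conv_power_0 convolve_one_left point_eval_linear del: conv_power.simps(1))
next
  case (Suc n)
  note f = Suc.prems
  let ?m = "conv_power H \<mu>" and ?n = "conv_power H \<nu>"
  have lin: "?m k \<in> linear_fnls" "?n k \<in> linear_fnls" for k
    using assms by (auto intro: conv_power_linear)
  obtain ts where comult: "represents_comult H f ts"
    using obtain_comult[OF f] .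
  note ts = represents_comultD[OF comult]
  define F where "F i j = convolve H (?m i) (?n j) f" for i j
  \<comment> \<open>The left factor \<open>\<nu>\<close> has to move past the power
    \<open>?m i\<close>, which is where commutation enters.\<close>
  have step: "convolve H (add_fnl \<mu> \<nu>) (convolve H (?m i) (?n j)) f = F (Suc i) j + F i (Suc j)" for i j
  proof -
    have "convolve H \<nu> (convolve H (?m i) (?n j)) = convolve H (convolve H (?m i) \<nu>) (?n j)"
      using commute_conv_power[OF assms(1,2) commute_sym[OF assms(3)], of i] assms lin
      by (simp add: convolve_assoc[symmetric] commute_def)
    also have "\<dots> = convolve H (?m i) (?n (Suc j))" using assms lin by (simp add: convolve_assoc)
    finally have "convolve H \<nu> (convolve H (?m i) (?n j)) = convolve H (?m i) (?n (Suc j))" .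
    thus ?thesis using assms lin f
      by (simp add: convolve_add_left convolve_linear convolve_assoc F_def add_fnl_apply)
  qed
  have "conv_power H (add_fnl \<mu> \<nu>) (Suc n) f =
      (\<Sum>u\<leftarrow>ts. add_fnl \<mu> \<nu> (fst u) * conv_power H (add_fnl \<mu> \<nu>) n (snd u))"
    using assms f by (simp add: convolve_comult[OF _ _ f comult] add_fnl_linear conv_power_linear)
  also have "\<dots> = (\<Sum>u\<leftarrow>ts. \<Sum>k\<le>n. of_nat (n choose k) *
      (add_fnl \<mu> \<nu> (fst u) * convolve H (?m k) (?n (n - k)) (snd u)))"
    by (intro arg_cong[where f = sum_list] map_cong refl)
      (simp add: Suc.IH ts sum_distrib_left mult.left_commute)
  also have "\<dots> = (\<Sum>k\<le>n. of_nat (n choose k) *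
      (\<Sum>u\<leftarrow>ts. add_fnl \<mu> \<nu> (fst u) * convolve H (?m k) (?n (n - k)) (snd u)))"
    by (induction ts) (simp_all add: sum.distrib distrib_left)
  also have "\<dots> = (\<Sum>k\<le>n. of_nat (n choose k) *
      convolve H (add_fnl \<mu> \<nu>) (convolve H (?m k) (?n (n - k))) f)"
    using assms lin by (simp add: convolve_comult[OF _ _ f comult] add_fnl_linear convolve_linear)
  also have "\<dots> = (\<Sum>k\<le>n. of_nat (n choose k) * F (Suc k) (n - k)) +
      (\<Sum>k\<le>n. of_nat (n choose k) * F k (Suc (n - k)))"
    by (simp add: step distrib_left sum.distrib)
  \<comment> \<open>The added term at \<open>k = Suc n\<close> is zero. Splitting off
    \<open>k = 0\<close> then aligns the two sums for Pascal's rule.\<close>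
  also have "(\<Sum>k\<le>n. of_nat (n choose k) * F k (Suc (n - k))) =
      (\<Sum>k\<le>Suc n. of_nat (n choose k) * F k (Suc n - k))"
    by (simp add: Suc_diff_le binomial_eq_0)
  also have "\<dots> = F 0 (Suc n) + (\<Sum>k\<le>n. of_nat (n choose Suc k) * F (Suc k) (n - k))"
    by (subst sum.atMost_Suc_shift) simp
  also have "(\<Sum>k\<le>n. of_nat (n choose k) * F (Suc k) (n - k)) + \<dots> =
      (\<Sum>k\<le>Suc n. of_nat (Suc n choose k) * F k (Suc n - k))"
    by (subst sum.atMost_Suc_shift) (simp add: sum.distrib algebra_simps)
  finally show ?case by (simp add: F_def)
qed

text \<open>In the binomial expansion the inner coefficients are divisible by the characteristic,
  and the two outer terms contain a vanishing \<open>p\<close>-th power.\<close>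

lemma conv_power_add_CHAR:
  assumes "\<mu> \<in> linear_fnls" "\<nu> \<in> linear_fnls" "commute \<mu> \<nu>" "prime CHAR('k)"
    and "conv_power H \<mu> CHAR('k) = zero_fnl H" "conv_power H \<nu> CHAR('k) = zero_fnl H"
  shows "conv_power H (add_fnl \<mu> \<nu>) CHAR('k) = zero_fnl H"
proof (rule fnl_eqI)
  fix f assume f: "f \<in> coord H"
  have "of_nat (CHAR('k) choose k) * convolve H (conv_power H \<mu> k) (conv_power H \<nu> (CHAR('k) - k)) f = 0"
    if k: "k \<le> CHAR('k)" for k
  proof -
    consider "k = 0" | "k = CHAR('k)" | "0 < k" "k < CHAR('k)" using k by linarith
    thus ?thesis
    proof cases
      case 3
      hence "CHAR('k) dvd (CHAR('k) choose k)" using assms(4) by (intro dvd_choose_prime) auto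
      thus ?thesis by (simp add: of_nat_eq_0_iff_char_dvd)
    qed (use assms f in \<open>simp_all add: convolve_zero zero_fnl_apply conv_power_linear point_eval_linear conv_power_0 del: conv_power.simps(1)\<close>)
  qed
  thus "conv_power H (add_fnl \<mu> \<nu>) CHAR('k) f = zero_fnl H f"
    unfolding conv_power_add[OF assms(1-3) f] using f by (simp add: zero_fnl_def sum.neutral del: mult_eq_0_iff)
qed (use assms in \<open>auto simp: zero_fnl_def intro!: linear_fnls_extensional conv_power_linear add_fnl_linear\<close>)

text \<open>Being fixed by \<open>Ad\<close> means \<open>h X h^(-1) = X\<close> in the dual
  algebra. Applying this to the right translate of \<open>f\<close> by \<open>h\<close> cancels the
  inverse.\<close>

lemma commute_point_eval_if_Ad_fixed:
  assumes "h \<in> carrier H" "X \<in> linear_fnls" "Ad H h X = X"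
  shows "commute (point_eval h) X"
  unfolding commute_def
proof (rule fnl_eqI)
  fix f assume f: "f \<in> coord H"
  let ?f = "\<lambda>x\<in>carrier H. f (x \<otimes> h)"
  have f': "?f \<in> coord H" using f assms by (simp add: coord_translate_right)
  have "convolve H X (point_eval h) f = X ?f"
    using assms f by (simp add: convolve_point_eval_right)
  also have "\<dots> = Ad H h X ?f" using assms by simp
  also have "\<dots> = X (\<lambda>x\<in>carrier H. ?f (h \<otimes> x \<otimes> inv h))" using f' by (simp add: Ad_def)
  also have "(\<lambda>x\<in>carrier H. ?f (h \<otimes> x \<otimes> inv h)) = (\<lambda>x\<in>carrier H. f (h \<otimes> x))"
    using assms(1) by (auto simp: m_assoc intro!: restrict_ext)
  also have "X \<dots> = convolve H (point_eval h) X f"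
    using assms f by (simp add: convolve_point_eval_left)
  finally show "convolve H (point_eval h) X f = convolve H X (point_eval h) f" by simp
qed (simp_all add: convolve_def)

section \<open>Coefficients of one-parameter subgroups\<close>

text \<open>Serves comorphisms into \<open>k[t]\<close> and into \<open>k[t]/(t^q)\<close> alike, so
  that the two kinds can be compared degree by degree.\<close>

definition coeff_fnl :: "(('a \<Rightarrow> 'k) \<Rightarrow> 'k poly) \<Rightarrow> nat \<Rightarrow> ('a, 'k) functional" where
  "coeff_fnl \<Phi> n = (\<lambda>f\<in>coord H. coeff (\<Phi> f) n)"

lemma coeff_fnl_extensional: "coeff_fnl \<Phi> n \<in> extensional (coord H)"
  by (simp add: coeff_fnl_def)

text \<open>This is the coefficient of \<open>s^i t^j\<close> in the compatibility of
  \<open>\<Phi>\<close> with comultiplication, i.e. the multiplication rule of divided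
  powers.\<close>

lemma convolve_coeff_fnl:
  assumes lin: "\<And>n. coeff_fnl \<Phi> n \<in> linear_fnls"
    and comult: "\<And>f ts. f \<in> coord H \<Longrightarrow> represents_comult H f ts \<Longrightarrow>
      (\<Sum>(g, h)\<leftarrow>ts. tensor_poly (\<Phi> g) (\<Phi> h)) = comult_poly (\<Phi> f)"
  shows "convolve H (coeff_fnl \<Phi> i) (coeff_fnl \<Phi> j) =
    scale_fnl H (of_nat ((i + j) choose i)) (coeff_fnl \<Phi> (i + j))"
proof (rule fnl_eqI)
  fix f assume f: "f \<in> coord H"
  obtain ts where ts: "represents_comult H f ts"
    using obtain_comult[OF f] .
  have "convolve H (coeff_fnl \<Phi> i) (coeff_fnl \<Phi> j) f =
      (\<Sum>u\<leftarrow>ts. coeff_fnl \<Phi> i (fst u) * coeff_fnl \<Phi> j (snd u))"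
    using lin by (intro convolve_comult f ts)
  also have "\<dots> = (\<Sum>u\<leftarrow>ts. coeff (\<Phi> (fst u)) i * coeff (\<Phi> (snd u)) j)"
    using represents_comultD[OF ts]
    by (intro arg_cong[where f = sum_list] map_cong refl) (simp add: coeff_fnl_def)
  also have "\<dots> = coeff (coeff (\<Sum>(g, h)\<leftarrow>ts. tensor_poly (\<Phi> g) (\<Phi> h)) j) i"
    by (simp add: coeff_sum_list coeff_tensor_poly case_prod_unfold)
  also have "\<dots> = of_nat ((i + j) choose i) * coeff (\<Phi> f) (i + j)"
    by (simp only: comult[OF f ts] coeff_comult_poly)
  finally show "convolve H (coeff_fnl \<Phi> i) (coeff_fnl \<Phi> j) f =
      scale_fnl H (of_nat ((i + j) choose i)) (coeff_fnl \<Phi> (i + j)) f"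
    using f by (simp add: scale_fnl_def coeff_fnl_def)
qed (simp_all add: convolve_def scale_fnl_def)

section \<open>One-parameter subgroups and their comorphisms\<close>

abbreviation "ops \<equiv> one_parameter_subgroup H"

abbreviation "ops_coeff \<eta> \<equiv> coeff_fnl (comorphism H \<eta>)"

lemma ops_closed: "ops \<eta> \<Longrightarrow> \<eta> s \<in> carrier H"
  and ops_add: "ops \<eta> \<Longrightarrow> \<eta> (s + t) = \<eta> s \<otimes> \<eta> t"
  by (simp_all add: one_parameter_subgroup_def)

lemma comorphism_eqI:
  assumes "f \<in> coord H" "\<And>s. poly P s = f (\<eta> s)"
  shows "comorphism H \<eta> f = P"
proof -
  have "(THE P. \<forall>s. poly P s = f (\<eta> s)) = P"
    using assms(2) by (intro the_equality) (auto intro: poly_eqI_alg_closed)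
  thus ?thesis using assms(1) by (simp add: comorphism_def)
qed

lemma poly_comorphism:
  assumes "ops \<eta>" "f \<in> coord H"
  shows "poly (comorphism H \<eta> f) s = f (\<eta> s)"
proof -
  obtain P where "\<forall>s. poly P s = f (\<eta> s)"
    using assms unfolding one_parameter_subgroup_def by blast
  thus ?thesis using comorphism_eqI[OF assms(2), of P \<eta>] by simp
qed

lemma comorphism_const:
  assumes "ops \<eta>"
  shows "comorphism H \<eta> (\<lambda>x\<in>carrier H. c) = [:c:]"
  using assms by (intro comorphism_eqI) (simp_all add: coord_const ops_closed)

lemma comorphism_scale:
  assumes "ops \<eta>" "f \<in> coord H"
  shows "comorphism H \<eta> (\<lambda>x\<in>carrier H. c * f x) = smult c (comorphism H \<eta> f)"
  using assms by (intro comorphism_eqI) (simp_all add: coord_scale ops_closed poly_comorphism)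

lemma comorphism_add:
  assumes "ops \<eta>" "f \<in> coord H" "g \<in> coord H"
  shows "comorphism H \<eta> (\<lambda>x\<in>carrier H. f x + g x) = comorphism H \<eta> f + comorphism H \<eta> g"
  using assms by (intro comorphism_eqI) (simp_all add: coord_add ops_closed poly_comorphism)

lemma comorphism_mult:
  assumes "ops \<eta>" "f \<in> coord H" "g \<in> coord H"
  shows "comorphism H \<eta> (\<lambda>x\<in>carrier H. f x * g x) = comorphism H \<eta> f * comorphism H \<eta> g"
  using assms by (intro comorphism_eqI) (simp_all add: coord_mult ops_closed poly_comorphism)

text \<open>Both sides take the value \<open>f (\<eta> (s + t))\<close> at every pair
  \<open>s\<close>, \<open>t\<close>, which suffices over an infinite field.\<close>

lemma comorphism_comult:
  assumes "ops \<eta>" "f \<in> coord H" "represents_comult H f ts"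
  shows "(\<Sum>(g, h)\<leftarrow>ts. tensor_poly (comorphism H \<eta> g) (comorphism H \<eta> h)) =
    comult_poly (comorphism H \<eta> f)"
proof (rule poly_poly_eqI_alg_closed)
  fix s t
  note D = represents_comultD[OF assms(3)]
  have "poly (poly (\<Sum>(g, h)\<leftarrow>ts. tensor_poly (comorphism H \<eta> g) (comorphism H \<eta> h)) [:t:]) s =
      (\<Sum>u\<leftarrow>ts. poly (comorphism H \<eta> (fst u)) s * poly (comorphism H \<eta> (snd u)) t)"
    by (simp add: poly_sum_list poly_tensor_poly case_prod_unfold)
  also have "\<dots> = (\<Sum>u\<leftarrow>ts. fst u (\<eta> s) * snd u (\<eta> t))"
    using D assms(1)
    by (intro arg_cong[where f = sum_list] map_cong refl) (simp add: poly_comorphism)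
  also have "\<dots> = f (\<eta> (s + t))" using assms(1) by (simp add: D(3) ops_closed ops_add)
  also have "\<dots> = poly (poly (comult_poly (comorphism H \<eta> f)) [:t:]) s"
    using assms by (simp add: poly_comorphism poly_comult_poly)
  finally show "poly (poly (\<Sum>(g, h)\<leftarrow>ts. tensor_poly (comorphism H \<eta> g) (comorphism H \<eta> h)) [:t:]) s =
    poly (poly (comult_poly (comorphism H \<eta> f)) [:t:]) s" .
qed

lemma ops_coeff_linear: "ops \<eta> \<Longrightarrow> ops_coeff \<eta> n \<in> linear_fnls"
  by (simp add: linear_fnls_def coeff_fnl_def coord_scale coord_add comorphism_scale comorphism_add)

lemma convolve_ops_coeff:
  "ops \<eta> \<Longrightarrow> convolve H (ops_coeff \<eta> i) (ops_coeff \<eta> j) =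
    scale_fnl H (of_nat ((i + j) choose i)) (ops_coeff \<eta> (i + j))"
  by (intro convolve_coeff_fnl ops_coeff_linear comorphism_comult)

lemma ops_zero:
  assumes "ops \<eta>" shows "\<eta> 0 = \<one>"
proof -
  have "\<eta> 0 \<otimes> \<eta> 0 = \<eta> 0" using ops_add[OF assms, of 0 0] by simp
  thus ?thesis using ops_closed[OF assms] by simp
qed

lemma ops_coeff_0: "ops \<eta> \<Longrightarrow> ops_coeff \<eta> 0 = point_eval \<one>"
  by (rule fnl_eqI)
    (simp_all add: coeff_fnl_def point_eval_def poly_0_coeff_0[symmetric] poly_comorphism ops_zero)

text \<open>At a fixed \<open>f\<close>, the products of \<open>\<mu>\<close> with the evaluation at
  \<open>\<eta> s\<close> in either order are polynomials in \<open>s\<close>. They agree for all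
  \<open>s\<close>, so their coefficients agree, and these are the products of \<open>\<mu>\<close>
  with the coefficients of \<open>\<eta>\<close>.\<close>

lemma commute_ops_coeff:
  assumes \<eta>: "ops \<eta>" and \<mu>: "\<mu> \<in> linear_fnls" and comm: "\<And>s. commute (point_eval (\<eta> s)) \<mu>"
  shows "commute \<mu> (ops_coeff \<eta> n)"
  unfolding commute_def
proof (rule fnl_eqI)
  fix f assume f: "f \<in> coord H"
  obtain ts where ts: "represents_comult H f ts"
    using obtain_comult[OF f] .
  note D = represents_comultD[OF ts]
  let ?P = "\<Sum>u\<leftarrow>ts. smult (\<mu> (snd u)) (comorphism H \<eta> (fst u))"
  let ?Q = "\<Sum>u\<leftarrow>ts. smult (\<mu> (fst u)) (comorphism H \<eta> (snd u))"
  have "?P = ?Q"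
  proof (rule poly_eqI_alg_closed)
    fix s
    have pe: "point_eval (\<eta> s) \<in> linear_fnls" using \<eta> by (simp add: point_eval_linear ops_closed)
    have "poly ?P s = (\<Sum>u\<leftarrow>ts. point_eval (\<eta> s) (fst u) * \<mu> (snd u))"
      using D \<eta> unfolding poly_sum_list
      by (intro arg_cong[where f = sum_list] map_cong refl) (simp add: poly_comorphism point_eval_def)
    also have "\<dots> = convolve H (point_eval (\<eta> s)) \<mu> f"
      using pe \<mu> f ts by (simp add: convolve_comult)
    also have "\<dots> = convolve H \<mu> (point_eval (\<eta> s)) f"
      using comm by (simp add: commute_def)
    also have "\<dots> = (\<Sum>u\<leftarrow>ts. \<mu> (fst u) * point_eval (\<eta> s) (snd u))"
      using pe \<mu> f ts by (simp add: convolve_comult)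
    also have "\<dots> = poly ?Q s"
      using D \<eta> unfolding poly_sum_list
      by (intro arg_cong[where f = sum_list] map_cong refl) (simp add: poly_comorphism point_eval_def)
    finally show "poly ?P s = poly ?Q s" .
  qed
  have "convolve H \<mu> (ops_coeff \<eta> n) f = (\<Sum>u\<leftarrow>ts. \<mu> (fst u) * ops_coeff \<eta> n (snd u))"
    using \<mu> f ts \<eta> by (simp add: convolve_comult ops_coeff_linear)
  also have "\<dots> = coeff ?Q n"
    using D unfolding coeff_sum_list
    by (intro arg_cong[where f = sum_list] map_cong refl) (simp add: coeff_fnl_def)
  also have "\<dots> = coeff ?P n" using \<open>?P = ?Q\<close> by simp
  also have "\<dots> = (\<Sum>u\<leftarrow>ts. ops_coeff \<eta> n (fst u) * \<mu> (snd u))"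
    using D unfolding coeff_sum_list
    by (intro arg_cong[where f = sum_list] map_cong refl) (simp add: coeff_fnl_def)
  also have "\<dots> = convolve H (ops_coeff \<eta> n) \<mu> f"
    using \<mu> f ts \<eta> by (simp add: convolve_comult ops_coeff_linear)
  finally show "convolve H \<mu> (ops_coeff \<eta> n) f = convolve H (ops_coeff \<eta> n) \<mu> f" .
qed (simp_all add: convolve_def)

section \<open>Products and Frobenius twists of one-parameter subgroups\<close>

lemma comorphism_product:
  assumes "ops \<eta>" "ops \<theta>" "f \<in> coord H" "represents_comult H f ts"
  shows "poly (\<Sum>u\<leftarrow>ts. comorphism H \<eta> (fst u) * comorphism H \<theta> (snd u)) s = f (\<eta> s \<otimes> \<theta> s)"
proof -
  note D = represents_comultD[OF assms(4)]
  have "poly (\<Sum>u\<leftarrow>ts. comorphism H \<eta> (fst u) * comorphism H \<theta> (snd u)) s =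
      (\<Sum>u\<leftarrow>ts. fst u (\<eta> s) * snd u (\<theta> s))"
    unfolding poly_sum_list using D assms
    by (intro arg_cong[where f = sum_list] map_cong refl) (simp add: poly_comorphism)
  thus ?thesis using assms by (simp add: D(3) ops_closed)
qed

lemma ops_product:
  assumes "ops \<eta>" "ops \<theta>" "\<And>s t. \<eta> s \<otimes> \<theta> t = \<theta> t \<otimes> \<eta> s"
  shows "ops (\<lambda>s. \<eta> s \<otimes> \<theta> s)"
  unfolding one_parameter_subgroup_def
proof (intro conjI allI ballI)
  fix s t
  note c = ops_closed[OF assms(1)] ops_closed[OF assms(2)]
  show "\<eta> s \<otimes> \<theta> s \<in> carrier H" using c by simp
  have "\<eta> (s + t) \<otimes> \<theta> (s + t) = \<eta> s \<otimes> (\<eta> t \<otimes> \<theta> s) \<otimes> \<theta> t"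
    using assms(1,2) c by (simp add: ops_add m_assoc)
  also have "\<dots> = \<eta> s \<otimes> \<theta> s \<otimes> (\<eta> t \<otimes> \<theta> t)"
    using c by (simp only: assms(3)[of t s]) (simp add: m_assoc)
  finally show "\<eta> (s + t) \<otimes> \<theta> (s + t) = \<eta> s \<otimes> \<theta> s \<otimes> (\<eta> t \<otimes> \<theta> t)" .
next
  fix f assume f: "f \<in> coord H"
  obtain ts where "represents_comult H f ts" using obtain_comult[OF f] .
  from comorphism_product[OF assms(1,2) f this]
  show "\<exists>P. \<forall>s. poly P s = f (\<eta> s \<otimes> \<theta> s)" by blast
qed

text \<open>The Cauchy product formula, with convolution as the product of coefficients.\<close>

lemma ops_coeff_product:
  assumes "ops \<eta>" "ops \<theta>" "f \<in> coord H"
  shows "ops_coeff (\<lambda>s. \<eta> s \<otimes> \<theta> s) n f =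
    (\<Sum>i\<le>n. convolve H (ops_coeff \<eta> i) (ops_coeff \<theta> (n - i)) f)"
proof -
  obtain ts where ts: "represents_comult H f ts" using obtain_comult[OF assms(3)] .
  note D = represents_comultD[OF ts]
  have "comorphism H (\<lambda>s. \<eta> s \<otimes> \<theta> s) f =
      (\<Sum>u\<leftarrow>ts. comorphism H \<eta> (fst u) * comorphism H \<theta> (snd u))"
    using assms ts by (intro comorphism_eqI comorphism_product)
  hence "ops_coeff (\<lambda>s. \<eta> s \<otimes> \<theta> s) n f =
      (\<Sum>u\<leftarrow>ts. \<Sum>i\<le>n. coeff (comorphism H \<eta> (fst u)) i * coeff (comorphism H \<theta> (snd u)) (n - i))"
    using assms(3) by (simp add: coeff_fnl_def coeff_sum_list coeff_mult)
  also have "\<dots> = (\<Sum>u\<leftarrow>ts. \<Sum>i\<le>n. ops_coeff \<eta> i (fst u) * ops_coeff \<theta> (n - i) (snd u))"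
    using D by (intro arg_cong[where f = sum_list] map_cong refl) (simp add: coeff_fnl_def)
  also have "\<dots> = (\<Sum>i\<le>n. \<Sum>u\<leftarrow>ts. ops_coeff \<eta> i (fst u) * ops_coeff \<theta> (n - i) (snd u))"
    by (induction ts) (simp_all add: sum.distrib)
  also have "\<dots> = (\<Sum>i\<le>n. convolve H (ops_coeff \<eta> i) (ops_coeff \<theta> (n - i)) f)"
    using assms ts by (simp add: convolve_comult ops_coeff_linear)
  finally show ?thesis .
qed

lemma ops_one: "ops (\<lambda>s. \<one>)"
  unfolding one_parameter_subgroup_def by (auto intro: exI[of _ "[:c:]" for c])

lemma comorphism_frobenius:
  assumes "ops \<eta>" "f \<in> coord H"
  shows "comorphism H (\<lambda>s. \<eta> (s ^ q)) f = pcompose (comorphism H \<eta> f) (monom 1 q)"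
  using assms by (intro comorphism_eqI) (simp_all add: poly_pcompose poly_monom poly_comorphism)

lemma ops_frobenius:
  assumes "ops \<eta>" "prime CHAR('k)"
  shows "ops (\<lambda>s. \<eta> (s ^ CHAR('k) ^ m))"
  unfolding one_parameter_subgroup_def
proof (intro conjI allI ballI)
  fix s t :: 'k
  show "\<eta> (s ^ CHAR('k) ^ m) \<in> carrier H" using assms by (simp add: ops_closed)
  show "\<eta> ((s + t) ^ CHAR('k) ^ m) = \<eta> (s ^ CHAR('k) ^ m) \<otimes> \<eta> (t ^ CHAR('k) ^ m)"
    using assms by (simp add: freshmans_dream' ops_add)
next
  fix f assume "f \<in> coord H"
  hence "poly (pcompose (comorphism H \<eta> f) (monom 1 (CHAR('k) ^ m))) s = f (\<eta> (s ^ CHAR('k) ^ m))" for s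
    using assms by (simp add: poly_pcompose poly_monom poly_comorphism)
  thus "\<exists>P. \<forall>s. poly P s = f (\<eta> (s ^ CHAR('k) ^ m))" by blast
qed

lemma ops_coeff_frobenius:
  assumes "ops \<eta>" "q > 0" "f \<in> coord H"
  shows "ops_coeff (\<lambda>s. \<eta> (s ^ q)) n f = (if q dvd n then ops_coeff \<eta> (n div q) f else 0)"
  using assms by (simp add: coeff_fnl_def comorphism_frobenius coeff_pcompose_monom)

text \<open>Up to order \<open>q\<close>, the twist \<open>\<theta>(s^q)\<close> contributes only its derivative, in degree \<open>q\<close>.\<close>

lemma ops_coeff_product_frobenius:
  assumes "ops \<eta>" "ops \<theta>" "ops (\<lambda>s. \<theta> (s ^ q))" "q > 0" "n \<le> q"
  shows "ops_coeff (\<lambda>s. \<eta> s \<otimes> \<theta> (s ^ q)) n =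
    (if n < q then ops_coeff \<eta> n else add_fnl (ops_coeff \<eta> n) (ops_coeff \<theta> 1))"
proof (rule fnl_eqI)
  fix f assume f: "f \<in> coord H"
  let ?\<theta> = "ops_coeff (\<lambda>s. \<theta> (s ^ q))"
  have \<theta>: "?\<theta> j = zero_fnl H" if "0 < j" "j < q" for j
  proof (rule fnl_eqI)
    fix f assume "f \<in> coord H"
    thus "?\<theta> j f = zero_fnl H f"
      using that assms by (simp add: ops_coeff_frobenius zero_fnl_def nat_dvd_not_less)
  qed (simp_all add: coeff_fnl_def zero_fnl_def)
  have \<theta>q: "?\<theta> q = ops_coeff \<theta> 1"
    by (rule fnl_eqI) (use assms in \<open>simp_all add: ops_coeff_frobenius, simp_all add: coeff_fnl_def\<close>)
  \<comment> \<open>In a pair of degrees \<open>i\<close> and \<open>n - i\<close>, the second is a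
    degree of the twist. Below or at \<open>q\<close> it contributes only in degrees 0 and
    \<open>q\<close>, and degree \<open>q\<close> forces \<open>i = 0\<close> and
    \<open>n = q\<close>.\<close>
  have F: "convolve H (ops_coeff \<eta> i) (?\<theta> (n - i)) f =
      (if i = n then ops_coeff \<eta> n f else if i = 0 \<and> n = q then ops_coeff \<theta> 1 f else 0)"
    if i: "i \<le> n" for i
  proof -
    consider "i = n" | "i = 0" "n = q" "i \<noteq> n" | "0 < n - i" "n - i < q" "\<not> (i = 0 \<and> n = q)" "i \<noteq> n"
      using i assms(5) by linarith
    thus ?thesis
      using assms f
      by cases (auto simp: ops_coeff_0 convolve_one_right convolve_one_left ops_coeff_linear
          \<theta> \<theta>q convolve_zero zero_fnl_apply)
  qed
  have "ops_coeff (\<lambda>s. \<eta> s \<otimes> \<theta> (s ^ q)) n f =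
      (\<Sum>i\<le>n. if i = n then ops_coeff \<eta> n f else if i = 0 \<and> n = q then ops_coeff \<theta> 1 f else 0)"
    by (simp add: ops_coeff_product[OF assms(1,3) f] F)
  also have "\<dots> = ops_coeff \<eta> n f + (\<Sum>i<n. if i = 0 \<and> n = q then ops_coeff \<theta> 1 f else 0)"
    by (simp add: lessThan_Suc_atMost[symmetric])
  also have "(\<Sum>i<n. if i = 0 \<and> n = q then ops_coeff \<theta> 1 f else 0) =
      (if n = q then ops_coeff \<theta> 1 f else 0)"
    using assms(4) by (simp add: sum.delta)
  finally show "ops_coeff (\<lambda>s. \<eta> s \<otimes> \<theta> (s ^ q)) n f =
      (if n < q then ops_coeff \<eta> n else add_fnl (ops_coeff \<eta> n) (ops_coeff \<theta> 1)) f"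
    using assms(5) f by (simp add: add_fnl_def)
qed (simp_all add: coeff_fnl_def add_fnl_def)

text \<open>The delicate point is comultiplication: truncation keeps \<open>i, j < q\<close> on one
  side but \<open>i + j < q\<close> on the other. In the remaining degrees the binomial coefficient
  vanishes because a carry occurs.\<close>

lemma restrict_ops_in_frobenius_kernel_hom:
  assumes "ops \<eta>" "prime CHAR('k)" "r > 0"
  shows "restrict_to_kernel H CHAR('k) r \<eta> \<in> frobenius_kernel_hom H CHAR('k) r"
proof -
  let ?q = "CHAR('k) ^ r" and ?\<phi> = "restrict_to_kernel H CHAR('k) r \<eta>"
  have q: "?q > 1" using assms(2,3) by (intro one_less_power prime_gt_1_nat)
  have coeff: "coeff (?\<phi> f) n = (if n < ?q then coeff (comorphism H \<eta> f) n else 0)"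
    if "f \<in> coord H" for f n
    using that by (simp add: restrict_to_kernel_def coeff_mod_monom)
  have "(\<Sum>(g, h)\<leftarrow>ts. tensor_poly (?\<phi> g) (?\<phi> h)) = comult_poly (?\<phi> f)"
    if f: "f \<in> coord H" and ts: "represents_comult H f ts" for f ts
  proof (intro poly_eqI)
    fix i j
    note D = represents_comultD[OF ts]
    have *: "(\<Sum>u\<leftarrow>ts. coeff (comorphism H \<eta> (fst u)) i * coeff (comorphism H \<eta> (snd u)) j) =
        of_nat ((i + j) choose i) * coeff (comorphism H \<eta> f) (i + j)"
      using arg_cong[OF comorphism_comult[OF assms(1) f ts], of "\<lambda>P. coeff (coeff P j) i"]
      by (simp add: coeff_sum_list coeff_tensor_poly coeff_comult_poly case_prod_unfold)
    have "coeff (coeff (\<Sum>(g, h)\<leftarrow>ts. tensor_poly (?\<phi> g) (?\<phi> h)) j) i =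
        (\<Sum>u\<leftarrow>ts. coeff (?\<phi> (fst u)) i * coeff (?\<phi> (snd u)) j)"
      by (simp add: coeff_sum_list coeff_tensor_poly case_prod_unfold)
    also have "\<dots> = (\<Sum>u\<leftarrow>ts. if i < ?q \<and> j < ?q then
        coeff (comorphism H \<eta> (fst u)) i * coeff (comorphism H \<eta> (snd u)) j else 0)"
      using D by (intro arg_cong[where f = sum_list] map_cong refl) (simp add: coeff)
    also have "\<dots> = (if i < ?q \<and> j < ?q then
        of_nat ((i + j) choose i) * coeff (comorphism H \<eta> f) (i + j) else 0)"
    proof (cases "i < ?q \<and> j < ?q")
      case False
      show ?thesis by (simp only: False if_False sum_list_0)
    qed (simp add: *)
    also have "\<dots> = of_nat ((i + j) choose i) * coeff (?\<phi> f) (i + j)"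
      using of_nat_choose_CHAR_power_carry[OF assms(2), of i r j] f by (auto simp: coeff)
    also have "\<dots> = coeff (coeff (comult_poly (?\<phi> f)) j) i" by (simp add: coeff_comult_poly)
    finally show "coeff (coeff (\<Sum>(g, h)\<leftarrow>ts. tensor_poly (?\<phi> g) (?\<phi> h)) j) i =
        coeff (coeff (comult_poly (?\<phi> f)) j) i" .
  qed
  moreover have "[:c:] mod monom 1 ?q = [:c:]" for c :: 'k
    using q prime_gt_0_nat[OF assms(2)] by (intro mod_poly_less) (simp add: degree_monom_eq)
  ultimately show ?thesis
    unfolding frobenius_kernel_hom_def using assms(1)
    by (auto simp: restrict_to_kernel_def frobenius_kernel_coord_def coord_const coord_add coord_mult
        comorphism_const comorphism_add comorphism_mult poly_mod_add_left mod_mult_eq)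
qed

section \<open>Coefficients of homomorphisms from Frobenius kernels\<close>

lemma hom_coeff_linear:
  assumes "\<phi> \<in> frobenius_kernel_hom H p r"
  shows "coeff_fnl \<phi> n \<in> linear_fnls"
proof -
  have \<phi>: "\<phi> (\<lambda>x\<in>carrier H. c) = [:c:]"
    "f \<in> coord H \<Longrightarrow> g \<in> coord H \<Longrightarrow> \<phi> (\<lambda>x\<in>carrier H. f x + g x) = \<phi> f + \<phi> g"
    "f \<in> coord H \<Longrightarrow> g \<in> coord H \<Longrightarrow>
      \<phi> (\<lambda>x\<in>carrier H. f x * g x) = (\<phi> f * \<phi> g) mod monom 1 (p ^ r)"
    "f \<in> coord H \<Longrightarrow> \<phi> f mod monom 1 (p ^ r) = \<phi> f" for c f g
    using assms by (auto simp: frobenius_kernel_hom_def frobenius_kernel_coord_def)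
  \<comment> \<open>Scalars are not part of the definition of a homomorphism; they come from
    products with constant functions.\<close>
  have "\<phi> (\<lambda>x\<in>carrier H. c * f x) = smult c (\<phi> f)" if f: "f \<in> coord H" for c f
  proof -
    have "(\<lambda>x\<in>carrier H. c * f x) = (\<lambda>x\<in>carrier H. (\<lambda>x\<in>carrier H. c) x * f x)"
      by (intro restrict_ext) simp
    hence "\<phi> (\<lambda>x\<in>carrier H. c * f x) = smult c (\<phi> f) mod monom 1 (p ^ r)"
      using \<phi>(3)[OF coord_const f, of c] by (simp add: \<phi>(1))
    also have "\<dots> = smult c (\<phi> f)" using \<phi>(4)[OF f] by (simp add: mod_smult_left)
    finally show ?thesis .
  qed
  thus ?thesis using \<phi>(2) by (simp add: linear_fnls_def coeff_fnl_def coord_scale coord_add)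
qed

lemma convolve_hom_coeff:
  assumes "\<phi> \<in> frobenius_kernel_hom H p r"
  shows "convolve H (coeff_fnl \<phi> i) (coeff_fnl \<phi> j) =
    scale_fnl H (of_nat ((i + j) choose i)) (coeff_fnl \<phi> (i + j))"
  using assms
  by (intro convolve_coeff_fnl hom_coeff_linear[OF assms]) (simp add: frobenius_kernel_hom_def)

lemma hom_coeff_mult:
  assumes "\<phi> \<in> frobenius_kernel_hom H p r" "f \<in> coord H" "g \<in> coord H" "n < p ^ r"
  shows "coeff_fnl \<phi> n (\<lambda>x\<in>carrier H. f x * g x) =
    (\<Sum>i\<le>n. coeff_fnl \<phi> i f * coeff_fnl \<phi> (n - i) g)"
proof -
  have "\<phi> (\<lambda>x\<in>carrier H. f x * g x) = (\<phi> f * \<phi> g) mod monom 1 (p ^ r)"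
    using assms by (auto simp: frobenius_kernel_hom_def)
  thus ?thesis using assms by (simp add: coeff_fnl_def coord_mult coeff_mod_monom coeff_mult)
qed

lemma ops_coeff_mult:
  assumes "ops \<eta>" "f \<in> coord H" "g \<in> coord H"
  shows "ops_coeff \<eta> n (\<lambda>x\<in>carrier H. f x * g x) =
    (\<Sum>i\<le>n. ops_coeff \<eta> i f * ops_coeff \<eta> (n - i) g)"
  using assms by (simp add: coeff_fnl_def coord_mult comorphism_mult coeff_mult)

text \<open>The constant coefficient is a character, hence evaluation at a point \<open>x\<close>.
  The convolution rule in degree 0 gives \<open>x \<otimes> x = x\<close>, so \<open>x\<close> is
  the identity. Thus the counit is preserved.\<close>

lemma hom_coeff_0:
  assumes "\<phi> \<in> frobenius_kernel_hom H p r" "p ^ r > 0"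
  shows "coeff_fnl \<phi> 0 = point_eval \<one>"
proof -
  have "algebra_character (carrier H) (coord H) (coeff_fnl \<phi> 0)"
    unfolding algebra_character_def
    using linear_fnls_add[OF hom_coeff_linear[OF assms(1)], of _ _ 0]
      hom_coeff_mult[OF assms(1), of _ _ 0] assms
    by (simp add: coeff_fnl_def coord_const) (simp add: frobenius_kernel_hom_def)
  then obtain x where x: "x \<in> carrier H" "\<And>f. f \<in> coord H \<Longrightarrow> coeff_fnl \<phi> 0 f = f x"
    using linear_algebraic_group unfolding linear_algebraic_group_def affine_variety_def by meson
  have eq: "coeff_fnl \<phi> 0 = point_eval x"
    by (rule fnl_eqI) (use x in \<open>simp_all add: point_eval_def\<close>, simp add: coeff_fnl_def)
  have "convolve H (coeff_fnl \<phi> 0) (coeff_fnl \<phi> 0) = coeff_fnl \<phi> 0"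
    unfolding convolve_hom_coeff[OF assms(1)] by (auto simp: scale_fnl_def coeff_fnl_def)
  hence xx: "point_eval (x \<otimes> x) = point_eval x"
    using x(1) by (simp add: eq convolve_point_eval)
  have "f (x \<otimes> x) = f x" if "f \<in> coord H" for f
    using fun_cong[OF xx, of f] that by (simp add: point_eval_def)
  hence "x \<otimes> x = x" using x(1) by (intro eq_if_coord_eq) auto
  hence "x = \<one>" using x(1) by simp
  thus ?thesis by (simp add: eq)
qed

section \<open>Consequences of the divided-power rule\<close>

lemma commute_coeff_fnl:
  assumes "\<And>i j. convolve H (coeff_fnl \<Phi> i) (coeff_fnl \<Phi> j) =
    scale_fnl H (of_nat ((i + j) choose i)) (coeff_fnl \<Phi> (i + j))"
  shows "commute (coeff_fnl \<Phi> i) (coeff_fnl \<Phi> j)"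
  using binomial_symmetric[of i "i + j"] by (simp add: commute_def assms add.commute)

text \<open>With \<open>q = p^m\<close>, powers of the coefficient in degree \<open>q\<close> are
  multiples of the coefficients in degrees \<open>a q\<close>. The last factor on the way to the
  \<open>p\<close>-th power is \<open>p q choose q\<close>, which is \<open>p = 0\<close> in the
  field.\<close>

lemma conv_power_coeff_fnl:
  assumes rule: "\<And>i j. convolve H (coeff_fnl \<Phi> i) (coeff_fnl \<Phi> j) =
      scale_fnl H (of_nat ((i + j) choose i)) (coeff_fnl \<Phi> (i + j))"
    and lin: "\<And>n. coeff_fnl \<Phi> n \<in> linear_fnls" and prime: "prime CHAR('k)"
  shows "conv_power H (coeff_fnl \<Phi> (CHAR('k) ^ m)) CHAR('k) = zero_fnl H"
proof -
  let ?q = "CHAR('k) ^ m"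
  \<comment> \<open>Exponents start at 1, because the zeroth power is the counit and nothing is
    assumed about the coefficient in degree 0.\<close>
  have "\<exists>c. conv_power H (coeff_fnl \<Phi> ?q) (Suc a) = scale_fnl H c (coeff_fnl \<Phi> (Suc a * ?q))" for a
  proof (induction a)
    case 0
    have "conv_power H (coeff_fnl \<Phi> ?q) (Suc 0) = coeff_fnl \<Phi> ?q"
      using lin by (simp add: conv_power_0 convolve_one_right del: conv_power.simps(1))
    also have "\<dots> = scale_fnl H 1 (coeff_fnl \<Phi> ?q)" by (auto simp: scale_fnl_def coeff_fnl_def)
    finally show ?case by auto
  next
    case (Suc a)
    then obtain c where
      "conv_power H (coeff_fnl \<Phi> ?q) (Suc a) = scale_fnl H c (coeff_fnl \<Phi> (Suc a * ?q))" by blast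
    hence "conv_power H (coeff_fnl \<Phi> ?q) (Suc (Suc a)) = scale_fnl H c (scale_fnl H
        (of_nat ((?q + Suc a * ?q) choose ?q)) (coeff_fnl \<Phi> (?q + Suc a * ?q)))"
      by (simp only: conv_power.simps(2)[of H _ "Suc a"] convolve_scale_right lin rule)
    also have "\<dots> = scale_fnl H (c * of_nat ((?q + Suc a * ?q) choose ?q))
        (coeff_fnl \<Phi> (Suc (Suc a) * ?q))"
      by (auto simp: scale_fnl_def mult.assoc)
    finally show ?case by blast
  qed
  \<comment> \<open>With this choice the \<open>p\<close>-th power is one factor times the power
    with exponent \<open>Suc a = p - 1\<close>.\<close>
  moreover define a where "a = CHAR('k) - 2"
  have a: "CHAR('k) = Suc (Suc a)" using prime_ge_2_nat[OF prime] by (simp add: a_def)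
  ultimately obtain c where
    c: "conv_power H (coeff_fnl \<Phi> ?q) (Suc a) = scale_fnl H c (coeff_fnl \<Phi> (Suc a * ?q))" by blast
  have "of_nat ((CHAR('k) * ?q + 0) choose ?q) = (of_nat CHAR('k) :: 'k)"
    using prime prime_gt_0_nat[OF prime] by (intro of_nat_mult_add_choose_CHAR_power) auto
  moreover have "?q + Suc a * ?q = CHAR('k) * ?q + 0" by (metis a add.right_neutral mult_Suc)
  ultimately have zero: "of_nat ((?q + Suc a * ?q) choose ?q) = (0 :: 'k)"
    by (simp del: mult_Suc)
  have "conv_power H (coeff_fnl \<Phi> ?q) CHAR('k) =
      convolve H (coeff_fnl \<Phi> ?q) (conv_power H (coeff_fnl \<Phi> ?q) (Suc a))"
    unfolding a by (rule conv_power.simps(2))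
  also have "\<dots> = scale_fnl H c (scale_fnl H 0 (coeff_fnl \<Phi> (?q + Suc a * ?q)))"
    by (simp only: c convolve_scale_right lin rule zero)
  also have "\<dots> = zero_fnl H" by (auto simp: scale_fnl_def zero_fnl_def)
  finally show ?thesis .
qed

text \<open>For \<open>p^m \<le> n < p^(m+1)\<close> the binomial coefficient \<open>n choose p^m\<close> is congruent modulo \<open>p\<close> to
  the leading digit of \<open>n\<close> to base \<open>p\<close>, hence invertible in \<open>k\<close>.\<close>

lemma coeff_fnl_determined:
  assumes rule_\<Phi>: "\<And>i j. convolve H (coeff_fnl \<Phi> i) (coeff_fnl \<Phi> j) =
      scale_fnl H (of_nat ((i + j) choose i)) (coeff_fnl \<Phi> (i + j))"
    and rule_\<Psi>: "\<And>i j. convolve H (coeff_fnl \<Psi> i) (coeff_fnl \<Psi> j) =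
      scale_fnl H (of_nat ((i + j) choose i)) (coeff_fnl \<Psi> (i + j))"
    and prime: "prime CHAR('k)"
    and eq: "\<And>n. n \<le> CHAR('k) ^ m \<Longrightarrow> coeff_fnl \<Phi> n = coeff_fnl \<Psi> n"
    and n: "n < CHAR('k) ^ Suc m"
  shows "coeff_fnl \<Phi> n = coeff_fnl \<Psi> n"
  using n
proof (induction n rule: less_induct)
  case (less n)
  let ?q = "CHAR('k) ^ m"
  show ?case
  proof (cases "n \<le> ?q")
    case False
    have q: "?q > 0" using prime_gt_0_nat[OF prime] by simp
    define c where "c = (of_nat (n choose ?q) :: 'k)"
    have "c = of_nat (n div ?q)"
      using of_nat_mult_add_choose_CHAR_power[OF prime, of "n mod ?q" m "n div ?q"] q
      by (simp add: c_def div_mult_mod_eq)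
    moreover have "0 < n div ?q" using False q by (simp add: div_greater_zero_iff)
    moreover have "n div ?q < CHAR('k)" using less.prems q by (simp add: less_mult_imp_div_less)
    ultimately have "c \<noteq> 0" by (auto simp: of_nat_eq_0_iff_char_dvd dest: nat_dvd_not_less)
    have n: "?q + (n - ?q) = n" using False by simp
    have "coeff_fnl \<Phi> (n - ?q) = coeff_fnl \<Psi> (n - ?q)"
      using less.prems False q by (intro less.IH) auto
    \<comment> \<open>Degree \<open>n\<close> is reached as \<open>?q + (n - ?q)\<close>. Both
      products are \<open>c\<close> times the respective coefficient in degree \<open>n\<close>, so
      \<open>c\<close> can be cancelled.\<close>
    hence "convolve H (coeff_fnl \<Phi> ?q) (coeff_fnl \<Phi> (n - ?q)) =
        convolve H (coeff_fnl \<Psi> ?q) (coeff_fnl \<Psi> (n - ?q))" by (simp add: eq)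
    hence "scale_fnl H c (coeff_fnl \<Phi> n) = scale_fnl H c (coeff_fnl \<Psi> n)"
      unfolding rule_\<Phi> rule_\<Psi> n c_def .
    hence eq: "c * coeff_fnl \<Phi> n f = c * coeff_fnl \<Psi> n f" if "f \<in> coord H" for f
      using that by (metis scale_fnl_def restrict_apply')
    show ?thesis
    proof (rule fnl_eqI)
      fix f assume "f \<in> coord H"
      thus "coeff_fnl \<Phi> n f = coeff_fnl \<Psi> n f" using eq \<open>c \<noteq> 0\<close> by simp
    qed (rule coeff_fnl_extensional)+
  qed (rule eq)
qed

end

section \<open>Products of exponentials\<close>

locale alg_group_with_exp = linear_alg_group H
  for H :: "('a, 'k::alg_closed_field) alg_group" (structure) +
  fixes \<E> :: "('a, 'k) functional \<Rightarrow> 'a"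
  assumes CHAR_pos: "CHAR('k) > 0"
    and exponential_map: "exponential_map H CHAR('k) \<E>"
begin

abbreviation "\<N> \<equiv> restricted_nullcone H CHAR('k)"

abbreviation "exp_prod \<equiv> exp_product H CHAR('k) \<E>"

lemma prime_CHAR: "prime CHAR('k)"
  using CHAR_pos by (rule prime_CHAR_semidom)

lemma nullcone_linear: "X \<in> \<N> \<Longrightarrow> X \<in> linear_fnls"
  by (simp add: restricted_nullcone_def lie_algebra_linear)

lemma nullcone_scale:
  assumes "X \<in> \<N>" shows "scale_fnl H c X \<in> \<N>"
proof -
  have "scale_fnl H c X \<in> lie_algebra H"
    using assms by (simp add: restricted_nullcone_def lie_algebra_def scale_fnl_def
        coord_scale coord_add coord_mult algebra_simps)
  moreover have "conv_power H (scale_fnl H c X) CHAR('k) = zero_fnl H"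
    unfolding conv_power_scale[OF nullcone_linear[OF assms]]
    using assms by (auto simp: restricted_nullcone_def scale_fnl_def zero_fnl_def)
  ultimately show ?thesis by (simp add: restricted_nullcone_def)
qed

lemma exp_ops: "X \<in> \<N> \<Longrightarrow> ops (\<lambda>s. \<E> (scale_fnl H s X))"
  using exponential_map by (simp add: exponential_map_def)

lemma exp_closed: "X \<in> \<N> \<Longrightarrow> \<E> (scale_fnl H s X) \<in> carrier H"
  using exp_ops by (rule ops_closed)

lemma exp_ops_coeff_1: "X \<in> \<N> \<Longrightarrow> ops_coeff (\<lambda>s. \<E> (scale_fnl H s X)) 1 = X"
  using exponential_map by (simp add: exponential_map_def differential_def u0_def coeff_fnl_def)

lemma Ad_exp:
  "X \<in> \<N> \<Longrightarrow> Y \<in> lie_algebra H \<Longrightarrow> commute X Y \<Longrightarrow> Ad H (\<E> (scale_fnl H s X)) Y = Y"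
  using exponential_map by (simp add: exponential_map_def lie_bracket_eq_zero_iff)

lemma commute_point_eval_exp:
  assumes "X \<in> \<N>" "Y \<in> lie_algebra H" "commute X Y"
  shows "commute (point_eval (\<E> (scale_fnl H s X))) Y"
  using assms by (intro commute_point_eval_if_Ad_fixed exp_closed lie_algebra_linear Ad_exp)

text \<open>By the centralizer condition, \<open>Ad\<close> of the first element fixes
  \<open>t Y\<close>. Equivariance of \<open>\<E>\<close> turns this into invariance of the second
  element under conjugation.\<close>

lemma exp_commute:
  assumes "X \<in> \<N>" "Y \<in> \<N>" "commute X Y"
  shows "\<E> (scale_fnl H s X) \<otimes> \<E> (scale_fnl H t Y) = \<E> (scale_fnl H t Y) \<otimes> \<E> (scale_fnl H s X)"
proof -
  let ?h = "\<E> (scale_fnl H s X)" and ?Y = "scale_fnl H t Y"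
  have Y: "?Y \<in> \<N>" using assms by (intro nullcone_scale)
  have "commute X ?Y" using assms by (intro commute_scale nullcone_linear)
  hence "Ad H ?h ?Y = ?Y" using assms Y by (intro Ad_exp) (simp_all add: restricted_nullcone_def)
  moreover have "\<E> (Ad H ?h ?Y) = ?h \<otimes> \<E> ?Y \<otimes> inv ?h"
    using exponential_map Y exp_closed[OF assms(1)] by (simp add: exponential_map_def)
  ultimately have "\<E> ?Y = ?h \<otimes> \<E> ?Y \<otimes> inv ?h" by simp
  thus ?thesis
    using exp_closed[OF assms(1), of s] exp_closed[OF assms(2), of t]
    by (metis inv_solve_right m_closed)
qed

section \<open>Products over commuting tuples\<close>

definition commuting :: "('a, 'k) functional list \<Rightarrow> bool" where
  "commuting Xs \<longleftrightarrow> set Xs \<subseteq> \<N> \<and> (\<forall>X\<in>set Xs. \<forall>Y\<in>set Xs. commute X Y)"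

lemma commuting_tuples_iff:
  "Xs \<in> commuting_tuples H CHAR('k) r \<longleftrightarrow> length Xs = r \<and> commuting Xs"
  unfolding commuting_tuples_def commuting_def lie_bracket_eq_zero_iff
  by (auto simp: all_set_conv_all_nth)

lemma exp_product_Nil: "exp_prod [] = (\<lambda>s. \<one>)"
  by (simp add: exp_product_def fun_eq_iff)

text \<open>\<open>foldr\<close> puts a new last factor innermost, in place of the initial value
  \<open>\<one>\<close>. Associativity brings it out to the right, which enables inductions that
  append an entry.\<close>

lemma exp_product_closed_snoc:
  assumes "set Xs \<subseteq> \<N>"
  shows exp_product_closed: "exp_prod Xs s \<in> carrier H"
    and exp_product_snoc: "Y \<in> \<N> \<Longrightarrow>
      exp_prod (Xs @ [Y]) s = exp_prod Xs s \<otimes> \<E> (scale_fnl H (s ^ CHAR('k) ^ length Xs) Y)"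
proof -
  let ?g = "\<lambda>Xs i. \<E> (scale_fnl H (s ^ CHAR('k) ^ i) (Xs ! i))"
  have g: "?g Xs i \<in> carrier H" if "i < length Xs" for i
    using that assms by (intro exp_closed) auto
  have closed: "foldr (\<lambda>i y. ?g Xs i \<otimes> y) is z \<in> carrier H"
    if "z \<in> carrier H" "set is \<subseteq> {..<length Xs}" for "is" z
    using that by (induction "is") (auto simp: g)
  have mult: "foldr (\<lambda>i y. ?g Xs i \<otimes> y) is z = foldr (\<lambda>i y. ?g Xs i \<otimes> y) is \<one> \<otimes> z"
    if "z \<in> carrier H" "set is \<subseteq> {..<length Xs}" for "is" z
    using that by (induction "is") (auto simp: g closed m_assoc)
  show "exp_prod Xs s \<in> carrier H" unfolding exp_product_def by (rule closed) auto
  assume Y: "Y \<in> \<N>"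
  let ?e = "\<E> (scale_fnl H (s ^ CHAR('k) ^ length Xs) Y)"
  have "exp_prod (Xs @ [Y]) s = foldr (\<lambda>i y. ?g (Xs @ [Y]) i \<otimes> y) [0..<length Xs] ?e"
    using exp_closed[OF Y] by (simp add: exp_product_def)
  also have "\<dots> = foldr (\<lambda>i y. ?g Xs i \<otimes> y) [0..<length Xs] ?e"
    by (intro foldr_cong) (auto simp: nth_append)
  also have "\<dots> = exp_prod Xs s \<otimes> ?e"
    unfolding exp_product_def using exp_closed[OF Y] by (intro mult) auto
  finally show "exp_prod (Xs @ [Y]) s = exp_prod Xs s \<otimes> ?e" .
qed

lemma exp_product_commute_exp:
  assumes "set Xs \<subseteq> \<N>" "Y \<in> \<N>" "\<And>X. X \<in> set Xs \<Longrightarrow> commute X Y"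
  shows "exp_prod Xs s \<otimes> \<E> (scale_fnl H t Y) = \<E> (scale_fnl H t Y) \<otimes> exp_prod Xs s"
  using assms(1,3)
proof (induction Xs rule: rev_induct)
  case Nil
  show ?case using exp_closed[OF assms(2)] by (simp add: exp_product_Nil)
next
  case (snoc X Xs)
  let ?x = "\<E> (scale_fnl H (s ^ CHAR('k) ^ length Xs) X)" and ?y = "\<E> (scale_fnl H t Y)"
  have c: "?x \<in> carrier H" "?y \<in> carrier H" "exp_prod Xs s \<in> carrier H"
    using snoc.prems assms(2) by (simp_all add: exp_closed exp_product_closed)
  have "exp_prod Xs s \<otimes> ?x \<otimes> ?y = exp_prod Xs s \<otimes> (?y \<otimes> ?x)"
    using snoc.prems assms(2) c by (simp add: m_assoc exp_commute[of X Y])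
  also have "\<dots> = ?y \<otimes> (exp_prod Xs s \<otimes> ?x)"
    using snoc c by (simp add: m_assoc[symmetric])
  finally show ?case using snoc.prems by (simp add: exp_product_snoc)
qed

text \<open>Evaluation at a product of group elements is the convolution of the evaluations, and
  each exponential factor commutes with \<open>Y\<close> by the centralizer condition.\<close>

lemma commute_point_eval_exp_product:
  assumes "set Xs \<subseteq> \<N>" "Y \<in> lie_algebra H" "\<And>X. X \<in> set Xs \<Longrightarrow> commute X Y"
  shows "commute (point_eval (exp_prod Xs s)) Y"
  using assms(1,3)
proof (induction Xs rule: rev_induct)
  case Nil
  show ?case using lie_algebra_linear[OF assms(2)]
    by (simp add: exp_product_Nil commute_def convolve_one_left convolve_one_right)
next
  case (snoc X Xs)
  have "commute Y (convolve H (point_eval (exp_prod Xs s))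
      (point_eval (\<E> (scale_fnl H (s ^ CHAR('k) ^ length Xs) X))))"
    using snoc assms(2)
    by (intro commute_convolve point_eval_linear exp_closed exp_product_closed lie_algebra_linear
        commute_sym[OF snoc.IH] commute_sym[OF commute_point_eval_exp]) auto
  thus ?case using snoc.prems
    by (simp add: exp_product_snoc convolve_point_eval exp_closed exp_product_closed commute_sym)
qed

lemma exp_product_snoc':
  assumes "commuting (Xs @ [Y])"
  shows "exp_prod (Xs @ [Y]) = (\<lambda>s. exp_prod Xs s \<otimes> \<E> (scale_fnl H (s ^ CHAR('k) ^ length Xs) Y))"
  using assms by (auto simp: commuting_def exp_product_snoc)

lemma commuting_appendD: "commuting (Xs @ Ys) \<Longrightarrow> commuting Xs"
  by (auto simp: commuting_def)

lemma exp_frobenius_ops: "X \<in> \<N> \<Longrightarrow> ops (\<lambda>s. \<E> (scale_fnl H (s ^ CHAR('k) ^ m) X))"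
  using ops_frobenius[OF exp_ops prime_CHAR] by simp

lemma exp_product_ops: "commuting Xs \<Longrightarrow> ops (exp_prod Xs)"
proof (induction Xs rule: rev_induct)
  case Nil
  show ?case by (simp add: exp_product_Nil ops_one)
next
  case (snoc X Xs)
  have "ops (\<lambda>s. exp_prod Xs s \<otimes> \<E> (scale_fnl H (s ^ CHAR('k) ^ length Xs) X))"
    using snoc.prems commuting_appendD[OF snoc.prems]
    by (intro ops_product snoc.IH exp_frobenius_ops exp_product_commute_exp) (auto simp: commuting_def)
  thus ?case using snoc.prems by (simp add: exp_product_snoc')
qed

text \<open>Positions count from 0, so the new factor is twisted by \<open>p^(length Xs)\<close>;
  its derivative before the twist is \<open>Y\<close>.\<close>

lemma exp_product_coeff_snoc:
  assumes "commuting (Xs @ [Y])" "n \<le> CHAR('k) ^ length Xs"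
  shows "ops_coeff (exp_prod (Xs @ [Y])) n =
    (if n < CHAR('k) ^ length Xs then ops_coeff (exp_prod Xs) n else add_fnl (ops_coeff (exp_prod Xs) n) Y)"
proof -
  have Y: "Y \<in> \<N>" using assms by (simp add: commuting_def)
  show ?thesis
    unfolding exp_product_snoc'[OF assms(1)]
    using ops_coeff_product_frobenius[OF exp_product_ops[OF commuting_appendD[OF assms(1)]]
        exp_ops[OF Y] exp_frobenius_ops[OF Y] _ assms(2)] CHAR_pos
    by (simp only: exp_ops_coeff_1[OF Y] zero_less_power)
qed

text \<open>Every factor of \<open>Zs\<close> is twisted by at least \<open>p^(length Xs)\<close>
  and therefore cannot affect lower degrees.\<close>

lemma exp_product_coeff_append:
  assumes "commuting (Xs @ Zs)" "n < CHAR('k) ^ length Xs"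
  shows "ops_coeff (exp_prod (Xs @ Zs)) n = ops_coeff (exp_prod Xs) n"
  using assms(1)
proof (induction Zs rule: rev_induct)
  case (snoc Z Zs)
  have "CHAR('k) ^ length Xs \<le> CHAR('k) ^ length (Xs @ Zs)"
    using CHAR_pos by (intro power_increasing) auto
  hence "n < CHAR('k) ^ length (Xs @ Zs)" using assms(2) by linarith
  hence "ops_coeff (exp_prod ((Xs @ Zs) @ [Z])) n = ops_coeff (exp_prod (Xs @ Zs)) n"
    using snoc.prems by (subst exp_product_coeff_snoc) auto
  thus ?case using snoc.IH snoc.prems commuting_appendD[of "Xs @ Zs" "[Z]"] by simp
qed simp

text \<open>Exhibits the entry \<open>Xs ! i\<close> as the difference of two coefficients, of the
  full product and of the product of the earlier entries.\<close>

lemma exp_product_coeff_nth: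
  assumes "commuting Xs" "i < length Xs"
  shows "ops_coeff (exp_prod Xs) (CHAR('k) ^ i) =
    add_fnl (ops_coeff (exp_prod (take i Xs)) (CHAR('k) ^ i)) (Xs ! i)"
proof -
  have split: "(take i Xs @ [Xs ! i]) @ drop (Suc i) Xs = Xs"
    using assms(2) by (simp add: id_take_nth_drop[symmetric])
  have len: "length (take i Xs) = i" using assms(2) by simp
  have "CHAR('k) ^ i < CHAR('k) ^ Suc i"
    using prime_gt_1_nat[OF prime_CHAR] by (intro power_strict_increasing) auto
  hence "ops_coeff (exp_prod Xs) (CHAR('k) ^ i) = ops_coeff (exp_prod (take i Xs @ [Xs ! i])) (CHAR('k) ^ i)"
    using exp_product_coeff_append[of "take i Xs @ [Xs ! i]" "drop (Suc i) Xs"] assms split len by simp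
  also have "\<dots> = add_fnl (ops_coeff (exp_prod (take i Xs)) (CHAR('k) ^ i)) (Xs ! i)"
    using exp_product_coeff_snoc[of "take i Xs" "Xs ! i" "CHAR('k) ^ i"] len
      commuting_appendD[of "take i Xs @ [Xs ! i]" "drop (Suc i) Xs"] assms split by simp
  finally show ?thesis .
qed

lemma add_fnl_left_cancel:
  assumes "add_fnl \<mu> \<nu> = add_fnl \<mu> \<rho>" "\<nu> \<in> linear_fnls" "\<rho> \<in> linear_fnls"
  shows "\<nu> = \<rho>"
proof (rule fnl_eqI)
  fix f assume f: "f \<in> coord H"
  show "\<nu> f = \<rho> f" using fun_cong[OF assms(1), of f] f by (simp add: add_fnl_apply)
qed (use assms in \<open>simp_all add: linear_fnls_extensional\<close>)

section \<open>Injectivity\<close>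

lemma coeff_exp_star:
  "f \<in> coord H \<Longrightarrow> n < CHAR('k) ^ r \<Longrightarrow>
    coeff (exp_star H CHAR('k) r \<E> Xs f) n = ops_coeff (exp_prod Xs) n f"
  by (simp add: exp_star_def restrict_to_kernel_def coeff_fnl_def coeff_mod_monom)

text \<open>The entries are recovered in order: once the first \<open>i\<close> agree, the
  coefficients in degree \<open>p^i\<close> force the next ones to agree. That degree survives
  truncation because \<open>i < r\<close>.\<close>

lemma exp_star_inj:
  assumes "commuting Xs" "commuting Ys" "length Xs = r" "length Ys = r"
    and eq: "exp_star H CHAR('k) r \<E> Xs = exp_star H CHAR('k) r \<E> Ys"
  shows "Xs = Ys"
proof -
  have coeff: "ops_coeff (exp_prod Xs) n = ops_coeff (exp_prod Ys) n" if "n < CHAR('k) ^ r" for n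
  proof (rule fnl_eqI)
    fix f assume "f \<in> coord H"
    thus "ops_coeff (exp_prod Xs) n f = ops_coeff (exp_prod Ys) n f"
      using coeff_exp_star[of f n r Xs] coeff_exp_star[of f n r Ys] that eq by simp
  qed (simp_all add: coeff_fnl_def)
  have "take i Xs = take i Ys" if "i \<le> r" for i
    using that
  proof (induction i)
    case (Suc i)
    have i: "CHAR('k) ^ i < CHAR('k) ^ r"
      using prime_gt_1_nat[OF prime_CHAR] Suc.prems by (intro power_strict_increasing) auto
    have "Xs ! i \<in> linear_fnls" "Ys ! i \<in> linear_fnls"
      using assms Suc.prems by (auto simp: commuting_def intro!: nullcone_linear)
    moreover have "add_fnl (ops_coeff (exp_prod (take i Xs)) (CHAR('k) ^ i)) (Xs ! i) =
        add_fnl (ops_coeff (exp_prod (take i Xs)) (CHAR('k) ^ i)) (Ys ! i)"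
      using exp_product_coeff_nth[OF assms(1), of i] exp_product_coeff_nth[OF assms(2), of i]
        coeff[OF i] Suc assms(3,4) by simp
    ultimately have "Xs ! i = Ys ! i" using add_fnl_left_cancel by blast
    thus ?case using Suc assms(3,4) by (simp add: take_Suc_conv_app_nth)
  qed simp
  from this[of r] show ?thesis using assms(3,4) by simp
qed

section \<open>Values of the map and surjectivity\<close>

lemma exp_star_in_frobenius_kernel_hom:
  assumes "commuting Xs" "r > 0"
  shows "exp_star H CHAR('k) r \<E> Xs \<in> frobenius_kernel_hom H CHAR('k) r"
  unfolding exp_star_def
  using assms by (intro restrict_ops_in_frobenius_kernel_hom exp_product_ops prime_CHAR)

lemma hom_agrees_extend:
  assumes \<phi>: "\<phi> \<in> frobenius_kernel_hom H CHAR('k) r" and m: "m < r"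
    and Xs: "commuting Xs" "length Xs = m"
    and agree: "\<And>n. n < CHAR('k) ^ m \<Longrightarrow> coeff_fnl \<phi> n = ops_coeff (exp_prod Xs) n"
  obtains Y where "commuting (Xs @ [Y])"
    and "\<And>n. n < CHAR('k) ^ Suc m \<Longrightarrow> coeff_fnl \<phi> n = ops_coeff (exp_prod (Xs @ [Y])) n"
proof -
  let ?q = "CHAR('k) ^ m"
  let ?d = "coeff_fnl \<phi>" and ?c = "ops_coeff (exp_prod Xs)"
  \<comment> \<open>Appending an entry adds it to the coefficient in degree \<open>?q\<close>, so it
    has to be the discrepancy between \<open>\<phi>\<close> and the product there.\<close>
  define Y where "Y = add_fnl (?d ?q) (scale_fnl H (- 1) (?c ?q))"
  note ops = exp_product_ops[OF Xs(1)]
  note d_lin = hom_coeff_linear[OF \<phi>] and c_lin = ops_coeff_linear[OF ops]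
  note d_comm = commute_coeff_fnl[OF convolve_hom_coeff[OF \<phi>]]
    and c_comm = commute_coeff_fnl[OF convolve_ops_coeff[OF ops]]
  have q: "0 < ?q" "?q < CHAR('k) ^ r"
    using prime_gt_1_nat[OF prime_CHAR] m by (auto intro: power_strict_increasing)
  have Y_lin: "Y \<in> linear_fnls"
    unfolding Y_def by (intro add_fnl_linear scale_fnl_linear d_lin c_lin)
  have sum_split: "(\<Sum>i\<le>?q. F i) = F 0 + F ?q + (\<Sum>i\<in>{0<..<?q}. F i)" for F :: "nat \<Rightarrow> 'k"
  proof -
    have "{..?q} = insert 0 (insert ?q {0<..<?q})" using q by auto
    thus ?thesis using q by (simp add: add.assoc)
  qed
  have Y_lie: "Y \<in> lie_algebra H"
  proof -
    have "Y (\<lambda>x\<in>carrier H. f x * g x) = f \<one> * Y g + Y f * g \<one>"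
      if f: "f \<in> coord H" and g: "g \<in> coord H" for f g
    proof -
      \<comment> \<open>The inner terms of the product rule involve only degrees strictly between 0
        and \<open>?q\<close>. There both sides agree, so these terms cancel in \<open>Y\<close>,
        leaving the Leibniz rule.\<close>
      have mid: "(\<Sum>i\<in>{0<..<?q}. ?d i f * ?d (?q - i) g) = (\<Sum>i\<in>{0<..<?q}. ?c i f * ?c (?q - i) g)"
        using q by (intro sum.cong refl arg_cong2[where f = "(*)"]) (simp_all add: agree)
      have "?d 0 h = h \<one>" "?c 0 h = h \<one>" if "h \<in> coord H" for h
        using that hom_coeff_0[OF \<phi> order.strict_trans[OF q]] ops_coeff_0[OF ops] by (simp_all add: point_eval_def)
      thus ?thesis
        using f g q
        by (simp add: Y_def add_fnl_apply scale_fnl_def coord_mult hom_coeff_mult[OF \<phi>]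
            ops_coeff_mult[OF ops] sum_split mid algebra_simps)
    qed
    thus ?thesis using Y_lin by (simp add: lie_algebra_def linear_fnls_def)
  qed
  have comm: "commute (Xs ! i) Y" if "i < m" for i
    using that
  proof (induction i rule: less_induct)
    case (less i)
    let ?e = "ops_coeff (exp_prod (take i Xs)) (CHAR('k) ^ i)"
    have take: "commuting (take i Xs)" using Xs(1) commuting_appendD[of "take i Xs" "drop i Xs"] by simp
    have X_lin: "Xs ! i \<in> linear_fnls"
      using Xs less.prems by (auto simp: commuting_def intro!: nullcone_linear)
    have e_lin: "?e \<in> linear_fnls" by (intro ops_coeff_linear exp_product_ops take)
    \<comment> \<open>By induction \<open>Y\<close> commutes with the earlier entries, hence with
      all values of their product and with its coefficients.\<close>
    have "commute Y ?e"
    proof (intro commute_ops_coeff exp_product_ops take Y_lin commute_point_eval_exp_product Y_lie)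
      fix X assume "X \<in> set (take i Xs)"
      then obtain j where "j < i" "X = Xs ! j" using less.prems Xs by (auto simp: in_set_conv_nth)
      thus "commute X Y" using less by simp
    qed (use take in \<open>simp add: commuting_def\<close>)
    \<comment> \<open>In the lower degree \<open>p^i\<close> the coefficients of
      \<open>\<phi>\<close> and of the product coincide, so this functional commutes with both
      constituents of \<open>Y\<close>.\<close>
    moreover have "commute (?c (CHAR('k) ^ i)) Y"
    proof -
      have "CHAR('k) ^ i < ?q"
        using prime_gt_1_nat[OF prime_CHAR] less.prems by (intro power_strict_increasing) auto
      hence "commute (?c (CHAR('k) ^ i)) (?d ?q)"
        using d_comm[of "CHAR('k) ^ i" ?q] by (simp add: agree)
      thus ?thesis unfolding Y_def
        by (intro commute_add commute_scale scale_fnl_linear d_lin c_lin c_comm)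
    qed
    moreover have "Xs ! i = add_fnl (?c (CHAR('k) ^ i)) (scale_fnl H (- 1) ?e)"
    proof (rule fnl_eqI)
      fix f assume "f \<in> coord H"
      thus "(Xs ! i) f = add_fnl (?c (CHAR('k) ^ i)) (scale_fnl H (- 1) ?e) f"
        using exp_product_coeff_nth[OF Xs(1), of i] less.prems Xs(2)
        by (simp add: add_fnl_apply scale_fnl_def)
    qed (use X_lin in \<open>simp_all add: linear_fnls_extensional add_fnl_def\<close>)
    ultimately have "commute Y (Xs ! i)"
      using Y_lin c_lin e_lin
      by (simp only:) (intro commute_add commute_scale scale_fnl_linear commute_sym[of "?c (CHAR('k) ^ i)" Y])
    thus ?case by (rule commute_sym)
  qed
  have Y_comm: "commute X Y" if "X \<in> set Xs" for X
    using that comm Xs(2) by (auto simp: in_set_conv_nth)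
  \<comment> \<open>Now that \<open>Y\<close> commutes with all entries, it commutes with
    \<open>?c ?q\<close>. Hence so does \<open>?d ?q\<close>, the sum of \<open>Y\<close> and
    \<open>?c ?q\<close>, as the binomial theorem requires.\<close>
  have "commute Y (?c ?q)"
    using Xs Y_comm by (intro commute_ops_coeff ops Y_lin commute_point_eval_exp_product Y_lie)
      (auto simp: commuting_def)
  moreover have "?d ?q = add_fnl Y (?c ?q)"
    by (rule fnl_eqI) (use d_lin in \<open>simp_all add: Y_def add_fnl_apply scale_fnl_def linear_fnls_extensional, simp add: add_fnl_def\<close>)
  ultimately have "commute (?c ?q) (?d ?q)"
    using commute_add[OF Y_lin c_lin c_lin, of ?q ?q] c_comm by (simp add: commute_sym)
  hence "conv_power H Y CHAR('k) = zero_fnl H"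
    unfolding Y_def
  proof (intro conv_power_add_CHAR d_lin scale_fnl_linear c_lin prime_CHAR commute_scale commute_sym[of "?c ?q"])
    show "conv_power H (?d ?q) CHAR('k) = zero_fnl H"
      by (intro conv_power_coeff_fnl convolve_hom_coeff[OF \<phi>] d_lin prime_CHAR)
    have "conv_power H (?c ?q) CHAR('k) = zero_fnl H"
      by (intro conv_power_coeff_fnl convolve_ops_coeff ops c_lin prime_CHAR)
    thus "conv_power H (scale_fnl H (- 1) (?c ?q)) CHAR('k) = zero_fnl H"
      unfolding conv_power_scale[OF c_lin] by (auto simp: scale_fnl_def zero_fnl_def)
  qed
  hence "Y \<in> \<N>" using Y_lie by (simp add: restricted_nullcone_def)
  hence comm_snoc: "commuting (Xs @ [Y])"
    using Xs(1) Y_comm by (auto simp: commuting_def intro: commute_sym) (simp add: commute_def)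
  show thesis
  proof (rule that[OF comm_snoc])
    fix n assume n: "n < CHAR('k) ^ Suc m"
    note ops' = exp_product_ops[OF comm_snoc]
    \<comment> \<open>Agreement up to and including degree \<open>?q\<close> determines all degrees
      below \<open>p^(m+1)\<close>; only these low degrees are left to check.\<close>
    show "?d n = ops_coeff (exp_prod (Xs @ [Y])) n"
    proof (rule coeff_fnl_determined[OF convolve_hom_coeff[OF \<phi>] convolve_ops_coeff[OF ops'] prime_CHAR _ n])
      fix n assume n: "n \<le> ?q"
      show "?d n = ops_coeff (exp_prod (Xs @ [Y])) n"
      proof (cases "n = ?q")
        case True
        have "?d ?q = add_fnl (?c ?q) Y"
          using \<open>?d ?q = add_fnl Y (?c ?q)\<close> by (simp add: add_fnl_def add.commute)
        thus ?thesis using exp_product_coeff_snoc[OF comm_snoc, of n] True Xs(2) by simp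
      next
        case False
        thus ?thesis using exp_product_coeff_snoc[OF comm_snoc, of n] n Xs(2) agree by simp
      qed
    qed
  qed
qed

lemma hom_agrees:
  assumes \<phi>: "\<phi> \<in> frobenius_kernel_hom H CHAR('k) r" and "m \<le> r"
  shows "\<exists>Xs. commuting Xs \<and> length Xs = m \<and>
    (\<forall>n < CHAR('k) ^ m. coeff_fnl \<phi> n = ops_coeff (exp_prod Xs) n)"
  using assms(2)
proof (induction m)
  case 0
  have "commuting []" by (simp add: commuting_def)
  \<comment> \<open>As \<open>p^0 = 1\<close>, only degree 0 is to be compared, and both
    coefficients there are evaluation at the identity.\<close>
  moreover have "coeff_fnl \<phi> 0 = ops_coeff (exp_prod []) 0"
    using hom_coeff_0[OF \<phi>] ops_coeff_0[OF exp_product_ops[OF calculation]] CHAR_pos by simp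
  ultimately show ?case by (intro exI[of _ "[]"]) simp
next
  case (Suc m)
  then obtain Xs where Xs: "commuting Xs" "length Xs = m"
    "\<And>n. n < CHAR('k) ^ m \<Longrightarrow> coeff_fnl \<phi> n = ops_coeff (exp_prod Xs) n" by auto
  obtain Y where "commuting (Xs @ [Y])"
    "\<And>n. n < CHAR('k) ^ Suc m \<Longrightarrow> coeff_fnl \<phi> n = ops_coeff (exp_prod (Xs @ [Y])) n"
    using hom_agrees_extend[OF \<phi> _ Xs] Suc.prems by (metis Suc_le_lessD)
  thus ?case using Xs(2) by (intro exI[of _ "Xs @ [Y]"]) simp
qed

text \<open>With \<open>m = r\<close> the coefficients agree in all degrees below
  \<open>p^r\<close>. Both sides are remainders modulo \<open>t^(p^r)\<close>, so the higher
  coefficients vanish.\<close>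

lemma exp_star_surj:
  assumes "\<phi> \<in> frobenius_kernel_hom H CHAR('k) r"
  shows "\<exists>Xs. commuting Xs \<and> length Xs = r \<and> exp_star H CHAR('k) r \<E> Xs = \<phi>"
proof -
  obtain Xs where Xs: "commuting Xs" "length Xs = r"
    "\<And>n. n < CHAR('k) ^ r \<Longrightarrow> coeff_fnl \<phi> n = ops_coeff (exp_prod Xs) n"
    using hom_agrees[OF assms order_refl] by auto
  have \<phi>: "\<phi> \<in> extensional (coord H)" "f \<in> coord H \<Longrightarrow> \<phi> f mod monom 1 (CHAR('k) ^ r) = \<phi> f" for f
    using assms by (auto simp: frobenius_kernel_hom_def frobenius_kernel_coord_def PiE_def)
  have "exp_star H CHAR('k) r \<E> Xs = \<phi>"
  proof (rule extensionalityI[of _ "coord H"])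
    fix f assume f: "f \<in> coord H"
    show "exp_star H CHAR('k) r \<E> Xs f = \<phi> f"
    proof (rule poly_eqI)
      fix n
      show "coeff (exp_star H CHAR('k) r \<E> Xs f) n = coeff (\<phi> f) n"
      proof (cases "n < CHAR('k) ^ r")
        case True
        have "ops_coeff (exp_prod Xs) n f = coeff_fnl \<phi> n f" by (simp add: Xs(3) True)
        thus ?thesis using f True by (simp add: coeff_exp_star) (simp add: coeff_fnl_def)
      next
        case False
        have "coeff (\<phi> f mod monom 1 (CHAR('k) ^ r)) n = 0" using False by (simp add: coeff_mod_monom)
        hence "coeff (\<phi> f) n = 0" using \<phi>(2)[OF f] by simp
        thus ?thesis using False f by (simp add: exp_star_def restrict_to_kernel_def coeff_mod_monom)
      qed
    qed
  qed (use \<phi> in \<open>simp_all add: exp_star_def restrict_to_kernel_def\<close>)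
  with Xs show ?thesis by blast
qed

end

theorem theorem2p5:
  fixes H :: "('a, 'k::alg_closed_field) alg_group"
    and \<E> :: "('a, 'k) functional \<Rightarrow> 'a"
    and p r :: nat
  assumes "CHAR('k) = p" and "p > 0"
    and "linear_algebraic_group H"
    and "exponential_map H p \<E>"
    and "r \<ge> 1"
  shows "bij_betw (exp_star H p r \<E>) (commuting_tuples H p r) (frobenius_kernel_hom H p r)"
proof -
  interpret alg_group_with_exp H \<E>
    by unfold_locales (use assms in auto)
  have p: "p = CHAR('k)" using assms(1) by simp
  show ?thesis
    unfolding bij_betw_def p
  proof (intro conjI inj_onI subset_antisym subsetI)
    fix Xs Ys
    assume "Xs \<in> commuting_tuples H CHAR('k) r" "Ys \<in> commuting_tuples H CHAR('k) r"
      "exp_star H CHAR('k) r \<E> Xs = exp_star H CHAR('k) r \<E> Ys"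
    thus "Xs = Ys" by (auto simp: commuting_tuples_iff intro: exp_star_inj)
  next
    fix \<phi> assume "\<phi> \<in> exp_star H CHAR('k) r \<E> ` commuting_tuples H CHAR('k) r"
    thus "\<phi> \<in> frobenius_kernel_hom H CHAR('k) r"
      using assms(5) by (auto simp: commuting_tuples_iff intro!: exp_star_in_frobenius_kernel_hom)
  next
    fix \<phi> assume "\<phi> \<in> frobenius_kernel_hom H CHAR('k) r"
    then obtain Xs where "commuting Xs" "length Xs = r" "exp_star H CHAR('k) r \<E> Xs = \<phi>"
      using exp_star_surj by blast
    thus "\<phi> \<in> exp_star H CHAR('k) r \<E> ` commuting_tuples H CHAR('k) r"
      by (intro image_eqI[of _ _ Xs]) (simp_all add: commuting_tuples_iff)
  qed
qed

end
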